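(* Let $N\in\mathbb{N}$, $p\ge1$ and $L>0$. On the set $\mathcal{P}_{p,L}(\mathbb{R}^N)$ of triangular $L$-Lipschitz measures the adapted Wasserstein distance and the Knothe--Rosenblatt distance are equivalent. That is, there exists a constant $C>0$ such that for all $\mu,\nu\in\mathcal{P}_{p,L}(\mathbb{R}^N)$ $$\mathcal{AW}_p(\mu,\nu)\le\mathcal{KR}_p(\mu,\nu)\le C\cdot\mathcal{AW}_p(\mu,\nu).$$
   Context: $\lambda$ is Lebesgue measure on $(0,1)$ and $\lambda^N$ the product measure on $(0,1)^N$. $|x|_p^p:=\sum_i|x_i|^p$, and $\mathcal{P}_p(\mathbb{R}^N)$ is the set of Borel probability measures on $\mathbb{R}^N$ with finite $p$-th moment. For $\mu\in\mathcal{P}_p(\mathbb{R}^N)$ write $\mu(dx)=\mu_1(dx_1)\mu_2^{x_1}(dx_2)\cdots\mu_N^{x_1,\dots,x_{N-1}}(dx_N)$ for the successive disintegration. $\mathcal{P}_{p,L}(\mathbb{R}^N)$ is the set of $\mu\in\mathcal{P}_p(\mathbb{R}^N)$ that are triangular $L$-Lipschitz, i.e. (for a version of the disintegration) for each $k\le N$ the kernel $\mathbb{R}^{k-1}\ni(x_1,\dots,x_{k-1})\mapsto\mu_k^{x_1,\dots,x_{k-1}}\in\mathcal{P}_p(\mathbb{R})$ is $L$-Lipschitz with respect to the $p$-Wasserstein distance on $\mathcal{P}_p(\mathbb{R})$ (and $|\cdot|_p$ on $\mathbb{R}^{k-1}$). A (measurable) map $Q=(Q_k)_{k=1}^N:(0,1)^N\to\mathbb{R}^N$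 is triangular if each $Q_k$ depends only on the first $k$ variables, and a triangular $Q$ is a quantile process if for all $k\le m\le N$ and $u_1,\dots,u_m,u_k'\in(0,1)$ with $u_k\le u_k'$: (inc) $Q_k(u_1,\dots,u_k)\le Q_k(u_1,\dots,u_{k-1},u_k')$; (con) if $Q_k(u_1,\dots,u_k)=Q_k(u_1,\dots,u_{k-1},u_k')$ then $Q_m(u_1,\dots,u_k,\dots,u_m)=Q_m(u_1,\dots,u_k',\dots,u_m)$. For every Borel probability $\mu$ on $\mathbb{R}^N$ there is a $\lambda^N$-a.s. unique quantile process $Q^\mu$ with $Q^\mu_\#\lambda^N=\mu$; explicitly, $Q^\mu_k(u_1,\dots,u_k)$ is the value at $u_k$ of the quantile function of $\mu_k^{Q^\mu_1(u_1),\dots,Q^\mu_{k-1}(u_1,\dots,u_{k-1})}$. The Knothe--Rosenblatt distance is $\mathcal{KR}_p(\mu,\nu):=\big(\int|Q^\mu-Q^\nu|_p^p\,d\lambda^N\big)^{1/p}$. A coupling $\pi$ of $\mu$ and $\nu$ is bicausal, $\pi\in\Pi_{\rm bc}(\mu,\nu)$, if its successive disintegration $\pi=\pi_1(dx_1,dy_1)\,\pi_2^{x_1,y_1}(dx_2,dy_2)\cdots$ satisfies, $\pi$-a.s. and for all $k\le N$, that $\pi_k^{x_1,\dots,x_{k-1},y_1,\dots,y_{k-1}}$ is a coupling of $\mu_k^{x_1,\dots,x_{k-1}}$ and $\nu_k^{y_1,\dots,y_{k-1}}$. The adapted Wasserstein distance is $\mathcal{AW}_p(\mu,\nu):=\inf_{\pi\in\Pi_{\rm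 bc}(\mu,\nu)}\big(\int|x-y|_p^p\,d\pi\big)^{1/p}$. *)

theory Defs
  imports "HOL-Probability.Probability"
begin

text \<open>
  A point of \<open>\<real>\<^sup>N\<close> is an extensional function on \<open>{..<N}\<close>, so coordinates are numbered from 0:
  coordinate \<open>k\<close> is the mathematical coordinate \<open>k + 1\<close> and its predecessors form a point of \<open>\<real>\<^sup>k\<close>.
\<close>

abbreviation RN :: "nat \<Rightarrow> (nat \<Rightarrow> real) measure" where
  "RN N \<equiv> PiM {..<N} (\<lambda>_. borel)"

definition unit_cube :: "nat \<Rightarrow> (nat \<Rightarrow> real) measure" where
  "unit_cube N = PiM {..<N} (\<lambda>_. restrict_space lborel {0<..<1})"

definition lp_pow :: "real \<Rightarrow> nat \<Rightarrow> (nat \<Rightarrow> real) \<Rightarrow> real" where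
  "lp_pow p N x = (\<Sum>i<N. \<bar>x i\<bar> powr p)"

definition lp_norm :: "real \<Rightarrow> nat \<Rightarrow> (nat \<Rightarrow> real) \<Rightarrow> real" where
  "lp_norm p N x = lp_pow p N x powr (1 / p)"

text \<open>The \<open>p\<close>-th root on \<open>[0, \<infinity>]\<close>, for \<open>p > 0\<close>.\<close>

definition ennroot :: "real \<Rightarrow> ennreal \<Rightarrow> ennreal" where
  "ennroot p t = (if t = \<top> then \<top> else ennreal (enn2real t powr (1 / p)))"

definition P_p :: "real \<Rightarrow> nat \<Rightarrow> (nat \<Rightarrow> real) measure set" where
  "P_p p N = {\<mu> \<in> space (prob_algebra (RN N)). (\<integral>\<^sup>+x. ennreal (lp_pow p N x) \<partial>\<mu>) < \<top>}"

definition P_p_real :: "real \<Rightarrow> real measure set" where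
  "P_p_real p = {\<mu> \<in> space (prob_algebra borel). (\<integral>\<^sup>+x. ennreal (\<bar>x\<bar> powr p) \<partial>\<mu>) < \<top>}"

definition couplings :: "'a measure \<Rightarrow> 'b measure \<Rightarrow> ('a \<times> 'b) measure set" where
  "couplings \<mu> \<nu> =
     {\<pi> \<in> space (prob_algebra (\<mu> \<Otimes>\<^sub>M \<nu>)). distr \<pi> \<mu> fst = \<mu> \<and> distr \<pi> \<nu> snd = \<nu>}"

definition wasserstein :: "real \<Rightarrow> real measure \<Rightarrow> real measure \<Rightarrow> ennreal" where
  "wasserstein p \<mu> \<nu> =
     (INF \<pi>\<in>couplings \<mu> \<nu>. ennroot p (\<integral>\<^sup>+(x, y). ennreal (\<bar>x - y\<bar> powr p) \<partial>\<pi>))"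

text \<open>The measure \<open>\<kappa>\<^sub>0(dx\<^sub>0) \<kappa>\<^sub>1\<^bsup>x\<^sub>0\<^esup>(dx\<^sub>1) \<cdots>\<close> on \<open>\<real>\<^sup>n\<close>.\<close>

primrec kernel_product :: "(nat \<Rightarrow> (nat \<Rightarrow> real) \<Rightarrow> real measure) \<Rightarrow> nat \<Rightarrow> (nat \<Rightarrow> real) measure" where
  "kernel_product \<kappa> 0 = return (RN 0) (\<lambda>_. undefined)"
| "kernel_product \<kappa> (Suc k) =
     kernel_product \<kappa> k \<bind> (\<lambda>x. distr (\<kappa> k x) (RN (Suc k)) (\<lambda>a. x(k := a)))"

definition disintegration ::
  "nat \<Rightarrow> (nat \<Rightarrow> real) measure \<Rightarrow> (nat \<Rightarrow> (nat \<Rightarrow> real) \<Rightarrow> real measure) \<Rightarrow> bool" where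
  "disintegration N \<mu> \<kappa> \<longleftrightarrow>
     (\<forall>k<N. \<kappa> k \<in> RN k \<rightarrow>\<^sub>M prob_algebra borel) \<and> \<mu> = kernel_product \<kappa> N"

definition P_pL :: "real \<Rightarrow> real \<Rightarrow> nat \<Rightarrow> (nat \<Rightarrow> real) measure set" where
  "P_pL p L N = {\<mu> \<in> P_p p N. \<exists>\<kappa>. disintegration N \<mu> \<kappa> \<and>
     (\<forall>k<N. \<kappa> k ` space (RN k) \<subseteq> P_p_real p \<and>
       (\<forall>x\<in>space (RN k). \<forall>y\<in>space (RN k).
          wasserstein p (\<kappa> k x) (\<kappa> k y) \<le> ennreal (L * lp_norm p k (\<lambda>i. x i - y i))))}"

text \<open>
  \<open>Q\<^sub>k\<close> is \<open>\<lambda>u. Q u k\<close>, defined on the whole cube. In the last two conditions the coordinates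
  of \<open>u\<close> beyond the ones in play are irrelevant, by the triangularity condition.
\<close>

definition quantile_process :: "nat \<Rightarrow> ((nat \<Rightarrow> real) \<Rightarrow> (nat \<Rightarrow> real)) \<Rightarrow> bool" where
  "quantile_process N Q \<longleftrightarrow>
     Q \<in> unit_cube N \<rightarrow>\<^sub>M RN N \<and>
     (\<forall>k<N. \<forall>u\<in>space (unit_cube N). \<forall>v\<in>space (unit_cube N).
        (\<forall>i\<le>k. u i = v i) \<longrightarrow> Q u k = Q v k) \<and>
     (\<forall>k<N. \<forall>u\<in>space (unit_cube N). \<forall>t\<in>{0<..<1}.
        u k \<le> t \<longrightarrow> Q u k \<le> Q (u(k := t)) k) \<and>
     (\<forall>m<N. \<forall>k\<le>m. \<forall>u\<in>space (unit_cube N). \<forall>t\<in>{0<..<1}.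
        u k \<le> t \<longrightarrow> Q u k = Q (u(k := t)) k \<longrightarrow> Q u m = Q (u(k := t)) m)"

text \<open>
  Such a process exists for every Borel probability measure on \<open>\<real>\<^sup>N\<close> and is unique almost surely,
  so the choice does not affect integrals over the cube.
\<close>

definition the_quantile_process ::
  "nat \<Rightarrow> (nat \<Rightarrow> real) measure \<Rightarrow> ((nat \<Rightarrow> real) \<Rightarrow> (nat \<Rightarrow> real))" where
  "the_quantile_process N \<mu> = (SOME Q. quantile_process N Q \<and> distr (unit_cube N) (RN N) Q = \<mu>)"

definition KR :: "real \<Rightarrow> nat \<Rightarrow> (nat \<Rightarrow> real) measure \<Rightarrow> (nat \<Rightarrow> real) measure \<Rightarrow> ennreal" where
  "KR p N \<mu> \<nu> = ennroot p (\<integral>\<^sup>+u. ennreal (lp_pow p N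
     (\<lambda>i. the_quantile_process N \<mu> u i - the_quantile_process N \<nu> u i)) \<partial>unit_cube N)"

primrec pair_kernel_product ::
  "(nat \<Rightarrow> (nat \<Rightarrow> real) \<times> (nat \<Rightarrow> real) \<Rightarrow> (real \<times> real) measure) \<Rightarrow> nat \<Rightarrow>
     ((nat \<Rightarrow> real) \<times> (nat \<Rightarrow> real)) measure" where
  "pair_kernel_product \<rho> 0 = return (RN 0 \<Otimes>\<^sub>M RN 0) (\<lambda>_. undefined, \<lambda>_. undefined)"
| "pair_kernel_product \<rho> (Suc k) =
     pair_kernel_product \<rho> k \<bind> (\<lambda>(x, y). distr (\<rho> k (x, y)) (RN (Suc k) \<Otimes>\<^sub>M RN (Suc k))
       (\<lambda>(a, b). (x(k := a), y(k := b))))"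

definition pair_disintegration ::
  "nat \<Rightarrow> ((nat \<Rightarrow> real) \<times> (nat \<Rightarrow> real)) measure \<Rightarrow>
     (nat \<Rightarrow> (nat \<Rightarrow> real) \<times> (nat \<Rightarrow> real) \<Rightarrow> (real \<times> real) measure) \<Rightarrow> bool" where
  "pair_disintegration N \<pi> \<rho> \<longleftrightarrow>
     (\<forall>k<N. \<rho> k \<in> RN k \<Otimes>\<^sub>M RN k \<rightarrow>\<^sub>M prob_algebra (borel \<Otimes>\<^sub>M borel)) \<and>
     \<pi> = pair_kernel_product \<rho> N"

text \<open>
  Disintegrations exist and are unique almost surely, and \<open>\<pi>\<close> has marginals \<open>\<mu>\<close> and \<open>\<nu>\<close>,
  so the condition does not depend on the versions \<open>\<kappa>\<close>, \<open>\<eta>\<close>, \<open>\<rho>\<close>.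
\<close>

definition bicausal_couplings ::
  "nat \<Rightarrow> (nat \<Rightarrow> real) measure \<Rightarrow> (nat \<Rightarrow> real) measure \<Rightarrow>
     ((nat \<Rightarrow> real) \<times> (nat \<Rightarrow> real)) measure set" where
  "bicausal_couplings N \<mu> \<nu> = {\<pi> \<in> couplings \<mu> \<nu>. \<exists>\<kappa> \<eta> \<rho>.
     disintegration N \<mu> \<kappa> \<and> disintegration N \<nu> \<eta> \<and> pair_disintegration N \<pi> \<rho> \<and>
     (AE (x, y) in \<pi>. \<forall>k<N. \<rho> k (restrict x {..<k}, restrict y {..<k})
        \<in> couplings (\<kappa> k (restrict x {..<k})) (\<eta> k (restrict y {..<k})))}"

definition AW :: "real \<Rightarrow> nat \<Rightarrow> (nat \<Rightarrow> real) measure \<Rightarrow> (nat \<Rightarrow> real) measure \<Rightarrow> ennreal" where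
  "AW p N \<mu> \<nu> = (INF \<pi>\<in>bicausal_couplings N \<mu> \<nu>.
     ennroot p (\<integral>\<^sup>+(x, y). ennreal (lp_pow p N (\<lambda>i. x i - y i)) \<partial>\<pi>))"

end

theory Submission
  imports Defs
begin

text \<open>
  \<^bold>\<open>Idea.\<close> Condition (con) forces the \<open>k\<close>-th coordinate of a quantile process \<open>Q\<close> to depend on
  \<open>u\<^sub>1, \<dots>, u\<^bsub>k-1\<^esub>\<close> only through \<open>Q\<^sub>1, \<dots>, Q\<^bsub>k-1\<^esub>\<close>, hence \<open>Q\<^sub>k = H\<^sub>k(Q\<^sub>1, \<dots>, Q\<^bsub>k-1\<^esub>, u\<^sub>k)\<close> with \<open>H\<^sub>k\<close>
  measurable and monotone in \<open>u\<^sub>k\<close>. So the joint law of two quantile processes is a bicausal coupling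
  whose kernels are comonotone, which gives \<open>AW \<le> KR\<close>.

  For the converse let \<open>\<gamma>\<close> be this coupling and \<open>\<pi>\<close> any bicausal one. Comonotone couplings are
  optimal on the line, so the conditional cost of step \<open>k\<close> of \<open>\<gamma>\<close> at a past \<open>(x', y')\<close> is the
  transport cost between the kernels of \<open>\<mu>\<close> at \<open>x'\<close> and of \<open>\<nu>\<close> at \<open>y'\<close>. The Lipschitz property
  replaces \<open>(x', y')\<close> by a past \<open>(x, y)\<close> drawn from \<open>\<pi>\<close> with \<open>x\<close> close to \<open>x'\<close>, where bicausality
  bounds this cost by the conditional cost of \<open>\<pi>\<close>. The price is a multiple of the distance of
  \<open>y\<close> and \<open>y'\<close>, which is at most about that of \<open>x\<close> and \<open>y\<close> plus that of \<open>x'\<close> and \<open>y'\<close>: these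
  are the costs of the previous steps, and induction on \<open>k\<close> concludes.
\<close>

section \<open>Comonotone couplings on the line\<close>

abbreviation unit_itv :: "real measure" where
  "unit_itv \<equiv> restrict_space lborel {0<..<1}"

lemma prob_space_unit_itv: "prob_space unit_itv"
  by (auto simp: emeasure_restrict_space space_restrict_space intro!: prob_spaceI)

interpretation unit_itv: prob_space unit_itv
  by (rule prob_space_unit_itv)

lemma space_unit_itv [simp]: "space unit_itv = {0<..<1}"
  by (simp add: space_restrict_space)

lemma pos_part_eq_integral:
  fixes z a :: real
  shows "ennreal (max 0 (x - (y + a))) = (\<integral>\<^sup>+s. indicator {s. s < x \<and> y \<le> s - a} s \<partial>lborel)"
proof -
  have "{s. s < x \<and> y \<le> s - a} = {y + a ..< x}" by auto
  then show ?thesis by (cases "y + a \<le> x") (auto simp: max_def)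
qed

text \<open>Taylor's formula with integral remainder at 0: the mixing measure has as density the
  second derivative of \<open>a powr p\<close> on the positive half-line, and for
  \<open>p = 1\<close> it degenerates to the point mass at 0. Sigma-finiteness is recorded for the
  exchange of integrals later.\<close>

lemma powr_eq_mixture:
  fixes p :: real
  assumes "p \<ge> 1"
  obtains m where "sigma_finite_measure m" "sets m = sets borel"
    "\<And>z. ennreal (max 0 z powr p) = (\<integral>\<^sup>+a. ennreal (max 0 (z - a)) \<partial>m)"
proof (cases "p = 1")
  case True
  show thesis
  proof
    show "sigma_finite_measure (return borel (0::real))"
      by (intro prob_space_imp_sigma_finite prob_space_return) simp
    fix z show "ennreal (max 0 z powr p) = (\<integral>\<^sup>+a. ennreal (max 0 (z - a)) \<partial>return borel 0)"
      by (subst nn_integral_return) (auto simp: True)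
  qed simp
next
  case False
  with assms have p: "p > 1" by simp
  define w :: "real \<Rightarrow> real" where "w a = indicator {0<..} a * (p * (p - 1) * a powr (p - 2))" for a
  have w0: "w a \<ge> 0" for a using p by (auto simp: w_def)
  have [measurable]: "w \<in> borel_measurable borel" unfolding w_def by measurable
  show thesis
  proof
    show "sigma_finite_measure (density lborel (\<lambda>a. ennreal (w a)))"
      by (subst sigma_finite_measure.sigma_finite_iff_density_finite[OF lborel.sigma_finite_measure_axioms]) auto
    show "sets (density lborel (\<lambda>a. ennreal (w a))) = sets borel" by simp
    fix z :: real
    show "ennreal (max 0 z powr p) = (\<integral>\<^sup>+a. ennreal (max 0 (z - a)) \<partial>density lborel (\<lambda>a. ennreal (w a)))"
    proof (cases "z > 0")
      case False
      then have "ennreal (w a) * ennreal (max 0 (z - a)) = 0" for a by (auto simp: w_def max_def)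
      note zero = this
      have "(\<integral>\<^sup>+a. ennreal (max 0 (z - a)) \<partial>density lborel (\<lambda>a. ennreal (w a))) = 0"
        by (subst nn_integral_density, measurable, unfold zero, simp)
      then show ?thesis using False by simp
    next
      case z: True
      \<comment> \<open>\<open>F\<close> is an antiderivative of the integrand \<open>f\<close>,
        found by parts: the derivative of \<open>a powr p\<close> cancels the term that comes from
        differentiating \<open>z - a\<close>.\<close>
      define F where "F a = p * a powr (p - 1) * (z - a) + a powr p" for a :: real
      define f where "f a = p * (p - 1) * a powr (p - 2) * (z - a)" for a :: real
      have "(f has_integral F z - F 0) {0..z}"
      \<comment> \<open>For \<open>p < 2\<close> the derivative of \<open>F\<close> is unbounded
        near 0, so only continuity is used at the end points.\<close>
      proof (rule fundamental_theorem_of_calculus_interior)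
        show "continuous_on {0..z} F" unfolding F_def using p
          by (intro continuous_intros continuous_on_powr') auto
        fix x assume x: "x \<in> {0<..<z}"
        have "(F has_real_derivative p * ((p - 1) * x powr (p - 1 - 1)) * (z - x)
            + p * x powr (p - 1) * (0 - 1) + p * x powr (p - 1)) (at x)"
          unfolding F_def using x
          by (intro derivative_eq_intros has_real_derivative_powr refl) auto
        moreover have "p - 1 - 1 = p - 2" by simp
        ultimately have "(F has_real_derivative f x) (at x)"
          unfolding f_def by (simp add: mult.assoc)
        then show "(F has_vector_derivative f x) (at x)"
          by (simp add: has_real_derivative_iff_has_vector_derivative)
      qed (use z in auto)
      moreover have "f x \<ge> 0" if "x \<in> {0..z}" for x using p that by (auto simp: f_def)
      ultimately have "(\<integral>\<^sup>+a. ennreal (indicator {0..z} a * f a) \<partial>lborel) = ennreal (F z - F 0)"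
        by (intro nn_integral_has_integral_lebesgue)
      also have "F z - F 0 = z powr p" using p by (simp add: F_def)
      also have "(\<integral>\<^sup>+a. ennreal (indicator {0..z} a * f a) \<partial>lborel)
          = (\<integral>\<^sup>+a. ennreal (w a) * ennreal (max 0 (z - a)) \<partial>lborel)"
        unfolding ennreal_mult'[OF w0, symmetric]
        by (intro nn_integral_cong arg_cong[where f=ennreal])
           (auto simp: w_def f_def max_def indicator_def)
      finally show ?thesis using z
        by (subst nn_integral_density) auto
    qed
  qed
qed

text \<open>Convex costs are mixtures of \<open>(z - a)\<^sup>+\<close>, and \<open>(x - y - a)\<^sup>+\<close> is the length of
  \<open>{s. y + a \<le> s < x}\<close>: only the probabilities of quadrants matter.\<close>

lemma nn_integral_pos_part_powr_mono:
  fixes X Y :: "'a \<Rightarrow> real" and X' Y' :: "'b \<Rightarrow> real"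
  assumes "prob_space M" "prob_space N" "p \<ge> 1"
    and [measurable]: "X \<in> borel_measurable M" "Y \<in> borel_measurable M"
      "X' \<in> borel_measurable N" "Y' \<in> borel_measurable N"
    and quad: "\<And>a b. emeasure M {z\<in>space M. a < X z \<and> Y z \<le> b}
                  \<le> emeasure N {z\<in>space N. a < X' z \<and> Y' z \<le> b}"
  shows "(\<integral>\<^sup>+z. ennreal (max 0 (X z - Y z) powr p) \<partial>M)
       \<le> (\<integral>\<^sup>+z. ennreal (max 0 (X' z - Y' z) powr p) \<partial>N)"
proof -
  obtain m :: "real measure" where m: "sigma_finite_measure m" and [measurable_cong]: "sets m = sets borel"
    and mix: "\<And>z. ennreal (max 0 z powr p) = (\<integral>\<^sup>+a. ennreal (max 0 (z - a)) \<partial>m)"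
    using powr_eq_mixture[OF \<open>p \<ge> 1\<close>] by blast
  interpret m: sigma_finite_measure m by fact
  \<comment> \<open>Mixture over \<open>a\<close>, length over \<open>s\<close>, and two exchanges
    of integrals leave only quadrant probabilities. The formula is stated for an arbitrary measure
    \<open>K\<close> because both sides are rewritten by it.\<close>
  have quadrants: "(\<integral>\<^sup>+z. ennreal (max 0 (X z - Y z) powr p) \<partial>K)
      = (\<integral>\<^sup>+a. (\<integral>\<^sup>+s. emeasure K {z\<in>space K. s < X z \<and> Y z \<le> s - a} \<partial>lborel) \<partial>m)"
    if K: "prob_space K" and [measurable]: "X \<in> borel_measurable K" "Y \<in> borel_measurable K"
    for K :: "'c measure" and X Y :: "'c \<Rightarrow> real"
  proof -
    interpret K: prob_space K by fact
    interpret P: pair_sigma_finite K m by unfold_locales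
    interpret P2: pair_sigma_finite K lborel by unfold_locales
    have "(\<integral>\<^sup>+z. ennreal (max 0 (X z - Y z) powr p) \<partial>K)
        = (\<integral>\<^sup>+z. \<integral>\<^sup>+a. ennreal (max 0 (X z - (Y z + a))) \<partial>m \<partial>K)"
      by (simp add: mix algebra_simps)
    also have "\<dots> = (\<integral>\<^sup>+a. \<integral>\<^sup>+z. ennreal (max 0 (X z - (Y z + a))) \<partial>K \<partial>m)"
      by (rule P.Fubini'[symmetric]) measurable
    also have "\<dots> = (\<integral>\<^sup>+a. \<integral>\<^sup>+z. \<integral>\<^sup>+s. indicator {s. s < X z \<and> Y z \<le> s - a} s \<partial>lborel \<partial>K \<partial>m)"
      by (simp only: pos_part_eq_integral)
    also have "\<dots> = (\<integral>\<^sup>+a. \<integral>\<^sup>+s. \<integral>\<^sup>+z. indicator {s. s < X z \<and> Y z \<le> s - a} s \<partial>K \<partial>lborel \<partial>m)"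
      by (intro nn_integral_cong P2.Fubini'[symmetric]) measurable
    also have "\<dots> = (\<integral>\<^sup>+a. \<integral>\<^sup>+s. \<integral>\<^sup>+z. indicator {z\<in>space K. s < X z \<and> Y z \<le> s - a} z \<partial>K \<partial>lborel \<partial>m)"
      by (intro nn_integral_cong) (auto simp: indicator_def)
    finally show ?thesis by simp
  qed
  show ?thesis
    unfolding quadrants[OF assms(1,4,5)] quadrants[OF assms(2,6,7)]
    by (intro nn_integral_mono quad)
qed

lemma measurable_mono_unit_itv:
  fixes h :: "real \<Rightarrow> real"
  assumes "mono_on {0<..<1} h"
  shows "h \<in> borel_measurable unit_itv"
  using borel_measurable_mono_on_fnc[OF assms] by (simp add: measurable_def sets_restrict_space space_restrict_space)

text \<open>For every coupling the quadrant has at least the sum of its two marginal probabilities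
  minus 1 (the Frechet lower bound). Monotone maps of one uniform variable attain this bound unless
  the quadrant is empty: \<open>{h > a}\<close> is an up-set and \<open>{h' \<le> b}\<close> a
  down-set of the interval, so once they meet they cover it.\<close>

lemma comonotone_quadrant_le:
  fixes h h' :: "real \<Rightarrow> real"
  assumes h: "mono_on {0<..<1} h" and h': "mono_on {0<..<1} h'"
    and "prob_space \<pi>" and [measurable]: "X \<in> borel_measurable \<pi>" "Y \<in> borel_measurable \<pi>"
    and X: "distr \<pi> borel X = distr unit_itv borel h"
    and Y: "distr \<pi> borel Y = distr unit_itv borel h'"
  shows "emeasure unit_itv {t\<in>space unit_itv. a < h t \<and> h' t \<le> b}
       \<le> emeasure \<pi> {z\<in>space \<pi>. a < X z \<and> Y z \<le> b}"
proof -
  interpret \<pi>: prob_space \<pi> by fact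
  note [measurable] = measurable_mono_unit_itv[OF h] measurable_mono_unit_itv[OF h']
  let ?A = "{t\<in>space unit_itv. a < h t}" and ?B = "{t\<in>space unit_itv. h' t \<le> b}"
  let ?A' = "{z\<in>space \<pi>. a < X z}" and ?B' = "{z\<in>space \<pi>. Y z \<le> b}"
  show ?thesis
  proof (cases "?A \<inter> ?B = {}")
    case True
    then have "{t\<in>space unit_itv. a < h t \<and> h' t \<le> b} = {}" by blast
    then show ?thesis by (simp only: emeasure_empty zero_le)
  next
    case False
    then obtain w where w: "w \<in> {0<..<1}" "a < h w" "h' w \<le> b" by auto
    have "?A \<union> ?B = space unit_itv"
    proof (intro equalityI subsetI)
      fix t assume t: "t \<in> space unit_itv"
      show "t \<in> ?A \<union> ?B"
      proof (cases "w \<le> t")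
        case True
        then have "h w \<le> h t" using h w t by (auto simp: mono_on_def)
        then show ?thesis using w t by auto
      next
        case False
        then have "h' t \<le> h' w" using h' w t by (auto simp: mono_on_def)
        then show ?thesis using w t by auto
      qed
    qed auto
    moreover have S: "?A \<in> unit_itv.events" "?B \<in> unit_itv.events" "?A' \<in> \<pi>.events" "?B' \<in> \<pi>.events"
      by measurable
    ultimately have 1: "unit_itv.prob ?A + unit_itv.prob ?B = 1 + unit_itv.prob (?A \<inter> ?B)"
      using unit_itv.finite_measure_Union'[OF S(1,2)] unit_itv.finite_measure_Diff'[OF S(2,1)]
        unit_itv.prob_space Int_commute[of ?A ?B] by simp
    have 2: "\<pi>.prob ?A' + \<pi>.prob ?B' \<le> 1 + \<pi>.prob (?A' \<inter> ?B')"
      using \<pi>.finite_measure_Union'[OF S(3,4)] \<pi>.finite_measure_Diff'[OF S(4,3)]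
        \<pi>.prob_le_1[of "?A' \<union> ?B'"] Int_commute[of ?A' ?B'] by simp
    have 3: "unit_itv.prob ?A = \<pi>.prob ?A'"
      using arg_cong[OF X, of "\<lambda>M. measure M {a<..}"]
      by (simp add: measure_distr vimage_def Int_def conj_commute)
    have 4: "unit_itv.prob ?B = \<pi>.prob ?B'"
      using arg_cong[OF Y, of "\<lambda>M. measure M {..b}"]
      by (simp add: measure_distr vimage_def Int_def conj_commute)
    have "unit_itv.prob (?A \<inter> ?B) \<le> \<pi>.prob (?A' \<inter> ?B')" using 1 2 3 4 by simp
    moreover have "?A \<inter> ?B = {t\<in>space unit_itv. a < h t \<and> h' t \<le> b}"
      "?A' \<inter> ?B' = {z\<in>space \<pi>. a < X z \<and> Y z \<le> b}" by auto
    ultimately show ?thesis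
      by (simp add: unit_itv.emeasure_eq_measure \<pi>.emeasure_eq_measure)
  qed
qed

text \<open>The cost splits into the powers of the positive parts of \<open>x - y\<close> and of
  \<open>y - x\<close>. Each is compared through quadrants, the second time with the two coordinates
  exchanged.\<close>

lemma comonotone_cost_le:
  fixes h h' :: "real \<Rightarrow> real"
  assumes "p \<ge> 1" and h: "mono_on {0<..<1} h" and h': "mono_on {0<..<1} h'"
    and \<pi>: "\<pi> \<in> couplings (distr unit_itv borel h) (distr unit_itv borel h')"
  shows "(\<integral>\<^sup>+t. ennreal (\<bar>h t - h' t\<bar> powr p) \<partial>unit_itv) \<le> (\<integral>\<^sup>+(x, y). ennreal (\<bar>x - y\<bar> powr p) \<partial>\<pi>)"
proof -
  note [measurable] = measurable_mono_unit_itv[OF h] measurable_mono_unit_itv[OF h']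
  have "prob_space \<pi>" and sets_\<pi>: "sets \<pi> = sets (borel \<Otimes>\<^sub>M borel)"
    using \<pi> by (auto simp: couplings_def space_prob_algebra cong: sets_pair_measure_cong)
  note [measurable_cong] = sets_\<pi>
  have distr: "distr \<pi> borel fst = distr unit_itv borel h" "distr \<pi> borel snd = distr unit_itv borel h'"
    using \<pi> by (auto simp: couplings_def cong: distr_cong)
  have split: "ennreal (\<bar>x - y\<bar> powr p) = ennreal (max 0 (x - y) powr p) + ennreal (max 0 (y - x) powr p)" for x y :: real
    using \<open>p \<ge> 1\<close> by (auto simp: max_def)
  have "(\<integral>\<^sup>+t. ennreal (\<bar>h t - h' t\<bar> powr p) \<partial>unit_itv)
     = (\<integral>\<^sup>+t. ennreal (max 0 (h t - h' t) powr p) \<partial>unit_itv)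
       + (\<integral>\<^sup>+t. ennreal (max 0 (h' t - h t) powr p) \<partial>unit_itv)"
    unfolding split by (rule nn_integral_add) measurable
  also have "\<dots> \<le> (\<integral>\<^sup>+z. ennreal (max 0 (fst z - snd z) powr p) \<partial>\<pi>)
       + (\<integral>\<^sup>+z. ennreal (max 0 (snd z - fst z) powr p) \<partial>\<pi>)"
    by (intro add_mono nn_integral_pos_part_powr_mono comonotone_quadrant_le
        prob_space_unit_itv \<open>prob_space \<pi>\<close> \<open>p \<ge> 1\<close> h h' distr) measurable
  also have "\<dots> = (\<integral>\<^sup>+z. ennreal (\<bar>fst z - snd z\<bar> powr p) \<partial>\<pi>)"
    unfolding split by (rule nn_integral_add[symmetric]) measurable
  finally show ?thesis by (simp only: case_prod_unfold)
qed

section \<open>Chains of kernels\<close>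

text \<open>A discrete gluing. Both measures give class \<open>i\<close> the same mass, so
  reweighting their product by the inverse of this mass on the pairs that share the class
  \<open>i\<close> gives a coupling of \<open>M\<close> and \<open>N\<close> carried by such pairs.
  The inequality is integrated against it; classes of mass 0 are discarded, which countability
  permits.\<close>

lemma nn_integral_le_along_classes:
  fixes c :: "'a \<Rightarrow> 'c::countable" and c' :: "'b \<Rightarrow> 'c" and f f' :: "'a \<Rightarrow> ennreal" and g :: "'b \<Rightarrow> ennreal"
  assumes M: "prob_space M" and N: "prob_space N"
    and c[measurable]: "c \<in> M \<rightarrow>\<^sub>M count_space UNIV" "c' \<in> N \<rightarrow>\<^sub>M count_space UNIV"
    and eq: "distr M (count_space UNIV) c = distr N (count_space UNIV) c'"
    and [measurable]: "f \<in> borel_measurable M" "f' \<in> borel_measurable M" "g \<in> borel_measurable N"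
    and le: "AE z in M. AE w in N. c z = c' w \<longrightarrow> f z \<le> g w + f' z"
  shows "(\<integral>\<^sup>+z. f z \<partial>M) \<le> (\<integral>\<^sup>+w. g w \<partial>N) + (\<integral>\<^sup>+z. f' z \<partial>M)"
proof -
  interpret M: prob_space M by fact
  interpret N: prob_space N by fact
  interpret P: pair_sigma_finite M N by unfold_locales
  define m where "m i = emeasure N {w\<in>space N. c' w = i}" for i
  have m': "m i = emeasure M {z\<in>space M. c z = i}" for i
    using arg_cong[OF eq, of "\<lambda>K. emeasure K {i}"]
    by (simp add: emeasure_distr m_def vimage_def Int_def conj_commute)
  \<comment> \<open>\<open>W\<close> is the density of the coupling with respect to the product;
    \<open>W1\<close> and \<open>W2\<close> below say that its marginals are \<open>M\<close> and
    \<open>N\<close>.\<close>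
  define W where "W z w = (if c z = c' w then inverse (m (c z)) else 0)" for z w
  have [measurable]: "(\<lambda>z. inverse (m (c z))) \<in> borel_measurable M"
    by (rule measurable_compose[OF c(1)]) simp
  have "{x\<in>space (M \<Otimes>\<^sub>M N). c (fst x) = c' (snd x)}
      = (\<Union>i. {x\<in>space (M \<Otimes>\<^sub>M N). c (fst x) = i \<and> c' (snd x) = i})" by auto
  also have "\<dots> \<in> sets (M \<Otimes>\<^sub>M N)" by measurable
  finally have [measurable]: "Measurable.pred (M \<Otimes>\<^sub>M N) (\<lambda>x. c (fst x) = c' (snd x))"
    by (simp add: pred_def)
  have [measurable]: "(\<lambda>(z, w). W z w) \<in> borel_measurable (M \<Otimes>\<^sub>M N)"
    unfolding W_def case_prod_unfold by measurable
  have [measurable]: "W z \<in> borel_measurable N" if "z \<in> space M" for z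
    unfolding W_def by measurable
  have [measurable]: "(\<lambda>z. W z w) \<in> borel_measurable M" if "w \<in> space N" for w
    unfolding W_def by measurable
  have norm: "inverse (m i) * m i = 1" if "m i \<noteq> 0" for i
    using ennreal_divide_self[of "m i"] that by (simp add: m_def divide_ennreal_def mult.commute flip: less_top)
  have pos: "AE z in M. m (c z) \<noteq> 0"
  proof -
    have "AE z in M. \<forall>i. m i = 0 \<longrightarrow> c z \<noteq> i"
      unfolding AE_all_countable
      by (auto simp: m' intro!: AE_I[where N="{z\<in>space M. c z = _}"])
    then show ?thesis by eventually_elim auto
  qed
  have pos': "AE w in N. m (c' w) \<noteq> 0"
  proof -
    have "AE w in N. \<forall>i. m i = 0 \<longrightarrow> c' w \<noteq> i"
      unfolding AE_all_countable
      by (auto simp: m_def intro!: AE_I[where N="{w\<in>space N. c' w = _}"])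
    then show ?thesis by eventually_elim auto
  qed
  have W1: "AE z in M. (\<integral>\<^sup>+w. W z w \<partial>N) = 1"
    using pos
  proof eventually_elim
    case (elim z)
    have "(\<integral>\<^sup>+w. W z w \<partial>N) = (\<integral>\<^sup>+w. inverse (m (c z)) * indicator {w\<in>space N. c' w = c z} w \<partial>N)"
      by (intro nn_integral_cong) (auto simp: W_def indicator_def)
    also have "\<dots> = inverse (m (c z)) * m (c z)"
      unfolding m_def by (subst nn_integral_cmult_indicator) auto
    finally show ?case using norm[OF elim] by simp
  qed
  have W2: "AE w in N. (\<integral>\<^sup>+z. W z w \<partial>M) = 1"
    using pos'
  proof eventually_elim
    case (elim w)
    have "(\<integral>\<^sup>+z. W z w \<partial>M) = (\<integral>\<^sup>+z. inverse (m (c' w)) * indicator {z\<in>space M. c z = c' w} z \<partial>M)"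
      by (intro nn_integral_cong) (auto simp: W_def indicator_def)
    also have "\<dots> = inverse (m (c' w)) * m (c' w)"
      unfolding m' by (subst nn_integral_cmult_indicator) auto
    finally show ?case using norm[OF elim] by simp
  qed
  have "(\<integral>\<^sup>+z. f z \<partial>M) = (\<integral>\<^sup>+z. f z * (\<integral>\<^sup>+w. W z w \<partial>N) \<partial>M)"
    using W1 by (intro nn_integral_cong_AE) (auto elim!: eventually_mono)
  also have "\<dots> = (\<integral>\<^sup>+z. \<integral>\<^sup>+w. f z * W z w \<partial>N \<partial>M)"
    by (intro nn_integral_cong nn_integral_cmult[symmetric]) measurable
  also have "\<dots> \<le> (\<integral>\<^sup>+z. \<integral>\<^sup>+w. g w * W z w + f' z * W z w \<partial>N \<partial>M)"
  proof (rule nn_integral_mono_AE, use le in eventually_elim)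
    case (elim z)
    then show ?case
      by (intro nn_integral_mono_AE, eventually_elim)
         (auto simp: W_def distrib_right[symmetric] intro!: mult_right_mono)
  qed
  also have "\<dots> = (\<integral>\<^sup>+z. (\<integral>\<^sup>+w. g w * W z w \<partial>N) + f' z * (\<integral>\<^sup>+w. W z w \<partial>N) \<partial>M)"
    by (intro nn_integral_cong) (subst nn_integral_add, auto simp: nn_integral_cmult)
  also have "\<dots> = (\<integral>\<^sup>+z. (\<integral>\<^sup>+w. g w * W z w \<partial>N) \<partial>M) + (\<integral>\<^sup>+z. f' z * (\<integral>\<^sup>+w. W z w \<partial>N) \<partial>M)"
    by (rule nn_integral_add) measurable
  also have "(\<integral>\<^sup>+z. f' z * (\<integral>\<^sup>+w. W z w \<partial>N) \<partial>M) = (\<integral>\<^sup>+z. f' z \<partial>M)"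
    using W1 by (intro nn_integral_cong_AE) (auto elim!: eventually_mono)
  also have "(\<integral>\<^sup>+z. (\<integral>\<^sup>+w. g w * W z w \<partial>N) \<partial>M) = (\<integral>\<^sup>+w. (\<integral>\<^sup>+z. g w * W z w \<partial>M) \<partial>N)"
    by (rule P.Fubini'[symmetric]) measurable
  also have "\<dots> = (\<integral>\<^sup>+w. g w * (\<integral>\<^sup>+z. W z w \<partial>M) \<partial>N)"
    by (intro nn_integral_cong nn_integral_cmult) measurable
  also have "\<dots> = (\<integral>\<^sup>+w. g w \<partial>N)"
    using W2 by (intro nn_integral_cong_AE) (auto elim!: eventually_mono)
  finally show ?thesis .
qed

section \<open>The cube of independent uniform variables\<close>

lemma prob_space_unit_cube: "prob_space (unit_cube n)"
  unfolding unit_cube_def by (intro prob_space_PiM prob_space_unit_itv)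

lemma space_unit_cube: "space (unit_cube n) = PiE {..<n} (\<lambda>_. {0<..<1})"
  by (simp add: unit_cube_def space_PiM)

lemma measurable_unit_cube_upd [measurable]:
  "(\<lambda>(u, t). u(k := t)) \<in> unit_cube k \<Otimes>\<^sub>M unit_itv \<rightarrow>\<^sub>M unit_cube (Suc k)"
  unfolding unit_cube_def lessThan_Suc by (rule measurable_add_dim)

lemma nn_integral_unit_cube_Suc:
  assumes "f \<in> borel_measurable (unit_cube (Suc k))"
  shows "(\<integral>\<^sup>+u. f u \<partial>unit_cube (Suc k)) = (\<integral>\<^sup>+u. \<integral>\<^sup>+t. f (u(k := t)) \<partial>unit_itv \<partial>unit_cube k)"
proof -
  interpret product_sigma_finite "\<lambda>_::nat. unit_itv"
    by (simp add: product_sigma_finite_def unit_itv.sigma_finite_measure_axioms)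
  show ?thesis using assms unfolding unit_cube_def lessThan_Suc
    by (intro product_nn_integral_insert) auto
qed

text \<open>The common structure of the single and the paired successive disintegration: states \<open>S k\<close>
  after \<open>k\<close> steps, extended by a value in \<open>V\<close>; \<open>r k\<close> forgets the later steps and \<open>val k\<close>
  reads off the value added in step \<open>k\<close>.\<close>

locale kernel_chain =
  fixes S :: "nat \<Rightarrow> 's measure" and V :: "'v measure"
    and upd :: "nat \<Rightarrow> 's \<Rightarrow> 'v \<Rightarrow> 's" and r :: "nat \<Rightarrow> 's \<Rightarrow> 's" and val :: "nat \<Rightarrow> 's \<Rightarrow> 'v"
    and K :: "nat \<Rightarrow> 's \<Rightarrow> 'v measure" and P :: "nat \<Rightarrow> 's measure" and s0 :: 's and n :: nat
  assumes upd_measurable [measurable]: "\<And>k. (\<lambda>(s, v). upd k s v) \<in> S k \<Otimes>\<^sub>M V \<rightarrow>\<^sub>M S (Suc k)"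
    and r_measurable: "\<And>k m. k \<le> m \<Longrightarrow> r k \<in> S m \<rightarrow>\<^sub>M S k"
    and val_measurable: "\<And>k m. k < m \<Longrightarrow> val k \<in> S m \<rightarrow>\<^sub>M V"
    and r_upd: "\<And>k m s v. k \<le> m \<Longrightarrow> r k (upd m s v) = r k s"
    and r_id: "\<And>k s. s \<in> space (S k) \<Longrightarrow> r k s = s"
    and r_r: "\<And>k m s. k \<le> m \<Longrightarrow> r k (r m s) = r k s"
    and val_upd: "\<And>k s v. val k (upd k s v) = v"
    and val_r: "\<And>k m s. k < m \<Longrightarrow> val k (r m s) = val k s"
    and s0: "s0 \<in> space (S 0)"
    and P_0: "P 0 = return (S 0) s0"
    and P_Suc: "\<And>k. P (Suc k) = P k \<bind> (\<lambda>s. distr (K k s) (S (Suc k)) (upd k s))"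
    and K_measurable: "\<And>k. k < n \<Longrightarrow> K k \<in> S k \<rightarrow>\<^sub>M prob_algebra V"
begin

lemma step_measurable:
  assumes "k < n"
  shows "(\<lambda>s. distr (K k s) (S (Suc k)) (upd k s)) \<in> S k \<rightarrow>\<^sub>M prob_algebra (S (Suc k))"
  using K_measurable[OF assms] by measurable

lemma P_in: "k \<le> n \<Longrightarrow> P k \<in> space (prob_algebra (S k))"
proof (induction k)
  case 0
  show ?case using s0 by (simp add: P_0 space_prob_algebra prob_space_return)
next
  case (Suc k)
  have "(\<lambda>s. distr (K k s) (S (Suc k)) (upd k s)) \<in> S k \<rightarrow>\<^sub>M prob_algebra (S (Suc k))"
    using Suc by (intro step_measurable) auto
  then show ?case using Suc
    by (auto simp: P_Suc space_prob_algebra intro!: prob_space_bind' sets_bind')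
qed

lemma prob_space_P: "k \<le> n \<Longrightarrow> prob_space (P k)"
  and sets_P: "k \<le> n \<Longrightarrow> sets (P k) = sets (S k)"
  using P_in by (auto simp: space_prob_algebra)

lemma space_P: "k \<le> n \<Longrightarrow> space (P k) = space (S k)"
  using sets_P by (rule sets_eq_imp_space_eq)

lemma K_in: "k < n \<Longrightarrow> s \<in> space (S k) \<Longrightarrow> K k s \<in> space (prob_algebra V)"
  using K_measurable by (rule measurable_space)

lemma sets_K: "k < n \<Longrightarrow> s \<in> space (S k) \<Longrightarrow> sets (K k s) = sets V"
  and prob_space_K: "k < n \<Longrightarrow> s \<in> space (S k) \<Longrightarrow> prob_space (K k s)"
  using K_in by (auto simp: space_prob_algebra)

lemma nn_integral_Suc:
  assumes "k < n" and [measurable]: "f \<in> borel_measurable (S (Suc k))"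
  shows "(\<integral>\<^sup>+s. f s \<partial>P (Suc k)) = (\<integral>\<^sup>+s. \<integral>\<^sup>+v. f (upd k s v) \<partial>K k s \<partial>P k)"
proof -
  have "(\<lambda>s. distr (K k s) (S (Suc k)) (upd k s)) \<in> P k \<rightarrow>\<^sub>M subprob_algebra (S (Suc k))"
    using measurable_prob_algebraD[OF step_measurable[OF \<open>k < n\<close>]] sets_P[of k] \<open>k < n\<close>
    by (simp cong: measurable_cong_sets)
  then have "(\<integral>\<^sup>+s. f s \<partial>P (Suc k)) = (\<integral>\<^sup>+s. \<integral>\<^sup>+v. f v \<partial>distr (K k s) (S (Suc k)) (upd k s) \<partial>P k)"
    unfolding P_Suc by (intro nn_integral_bind) measurable
  also have "\<dots> = (\<integral>\<^sup>+s. \<integral>\<^sup>+v. f (upd k s v) \<partial>K k s \<partial>P k)"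
  proof (rule nn_integral_cong)
    fix s assume "s \<in> space (P k)"
    then have s[measurable]: "s \<in> space (S k)" using space_P[of k] \<open>k < n\<close> by simp
    note [measurable_cong] = sets_K[OF \<open>k < n\<close> s]
    have "upd k s \<in> K k s \<rightarrow>\<^sub>M S (Suc k)" by measurable
    then show "(\<integral>\<^sup>+v. f v \<partial>distr (K k s) (S (Suc k)) (upd k s)) = (\<integral>\<^sup>+v. f (upd k s v) \<partial>K k s)"
      by (intro nn_integral_distr) measurable
  qed
  finally show ?thesis .
qed

text \<open>Each later kernel has mass 1 and \<open>r k\<close> does not see the value it adds, so
  the steps from \<open>k\<close> on integrate out.\<close>

lemma nn_integral_r:
  assumes "k \<le> m" "m \<le> n" and f: "f \<in> borel_measurable (S k)"
  shows "(\<integral>\<^sup>+s. f (r k s) \<partial>P m) = (\<integral>\<^sup>+s. f s \<partial>P k)"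
  using assms(1,2)
proof (induction m rule: dec_induct)
  case base
  then show ?case by (intro nn_integral_cong) (simp add: space_P r_id)
next
  case (step m)
  have "(\<integral>\<^sup>+s. f (r k s) \<partial>P (Suc m)) = (\<integral>\<^sup>+s. \<integral>\<^sup>+v. f (r k (upd m s v)) \<partial>K m s \<partial>P m)"
    using step measurable_compose[OF r_measurable f, of "Suc m"] by (intro nn_integral_Suc) auto
  also have "\<dots> = (\<integral>\<^sup>+s. f (r k s) \<partial>P m)"
    using step prob_space_K[of m]
    by (intro nn_integral_cong) (auto simp: r_upd space_P prob_space.emeasure_space_1)
  finally show ?case using step by simp
qed

text \<open>The disintegration property read at the final time: under \<open>P n\<close> the value
  added in step \<open>k\<close> has conditional law \<open>K k\<close> given the past. The later
  steps are dropped, \<open>P (Suc k)\<close> is unfolded, and the past is lifted back to time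
  \<open>n\<close>.\<close>

lemma nn_integral_step:
  assumes "k < n" and f[measurable]: "case_prod f \<in> borel_measurable (S k \<Otimes>\<^sub>M V)"
  shows "(\<integral>\<^sup>+s. f (r k s) (val k s) \<partial>P n) = (\<integral>\<^sup>+s. (\<integral>\<^sup>+v. f (r k s) v \<partial>K k (r k s)) \<partial>P n)"
proof -
  note [measurable] = r_measurable val_measurable
  have [measurable]: "K k \<in> S k \<rightarrow>\<^sub>M subprob_algebra V"
    using K_measurable[OF \<open>k < n\<close>] by (rule measurable_prob_algebraD)
  have 1: "(\<lambda>s. f (r k s) (val k s)) \<in> borel_measurable (S (Suc k))"
    using r_measurable[of k "Suc k"] val_measurable[of k "Suc k"] by measurable
  have 2: "(\<lambda>s. \<integral>\<^sup>+v. f s v \<partial>K k s) \<in> borel_measurable (S k)"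
    by (rule nn_integral_measurable_subprob_algebra2) measurable
  \<comment> \<open>Inserting \<open>r (Suc k)\<close>, which keeps both the past and the value of
    step \<open>k\<close>, makes \<open>nn_integral_r\<close> applicable.\<close>
  have "(\<integral>\<^sup>+s. f (r k s) (val k s) \<partial>P n)
      = (\<integral>\<^sup>+s. (\<lambda>s. f (r k s) (val k s)) (r (Suc k) s) \<partial>P n)"
    by (simp add: r_r val_r)
  also have "\<dots> = (\<integral>\<^sup>+s. f (r k s) (val k s) \<partial>P (Suc k))"
    using \<open>k < n\<close> by (intro nn_integral_r 1) auto
  also have "\<dots> = (\<integral>\<^sup>+s. (\<integral>\<^sup>+v. f s v \<partial>K k s) \<partial>P k)"
    unfolding nn_integral_Suc[OF \<open>k < n\<close> 1] using \<open>k < n\<close>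
    by (intro nn_integral_cong) (simp add: r_upd val_upd r_id space_P)
  also have "\<dots> = (\<integral>\<^sup>+s. (\<integral>\<^sup>+v. f (r k s) v \<partial>K k (r k s)) \<partial>P n)"
    using \<open>k < n\<close> by (intro nn_integral_r[symmetric] 2) auto
  finally show ?thesis .
qed

text \<open>Simulation by independent uniform variables: as \<open>g k s\<close> pushes the uniform
  law to the kernel, each new coordinate of the cube performs one step of the chain. It serves for
  one composed map and for two maps driven by the same \<open>u\<close>.\<close>

lemma law:
  assumes "k \<le> n"
    and Z: "\<And>k. k \<le> n \<Longrightarrow> Z k \<in> unit_cube k \<rightarrow>\<^sub>M S k"
    and Z_0: "\<And>u. Z 0 u = s0"
    and Z_Suc: "\<And>k u t. k < n \<Longrightarrow> u \<in> space (unit_cube k) \<Longrightarrow> t \<in> {0<..<1} \<Longrightarrow>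
      Z (Suc k) (u(k := t)) = upd k (Z k u) (g k (Z k u) t)"
    and K: "\<And>k s. k < n \<Longrightarrow> s \<in> space (S k) \<Longrightarrow> K k s = distr unit_itv V (g k s)"
    and g: "\<And>k s. k < n \<Longrightarrow> s \<in> space (S k) \<Longrightarrow> g k s \<in> unit_itv \<rightarrow>\<^sub>M V"
  shows "P k = distr (unit_cube k) (S k) (Z k)"
  using \<open>k \<le> n\<close>
proof (induction k)
  case 0
  interpret prob_space "unit_cube 0" by (rule prob_space_unit_cube)
  have "Z 0 = (\<lambda>_. s0)" using Z_0 by auto
  then show ?case using distr_const[OF s0] by (simp add: P_0)
next
  case (Suc k)
  then have k: "k < n" by simp
  note [measurable] = Z[of k] Z[of "Suc k"]
  show ?case
  proof (rule measure_eqI)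
    show "sets (P (Suc k)) = sets (distr (unit_cube (Suc k)) (S (Suc k)) (Z (Suc k)))"
      using Suc sets_P by simp
    fix A assume "A \<in> sets (P (Suc k))"
    then have A[measurable]: "A \<in> sets (S (Suc k))" using sets_P Suc by simp
    have [measurable]: "(\<lambda>s. \<integral>\<^sup>+v. indicator A (upd k s v) \<partial>K k s) \<in> borel_measurable (S k)"
      using measurable_prob_algebraD[OF K_measurable[OF k]]
      by (intro nn_integral_measurable_subprob_algebra2) measurable
    have "emeasure (P (Suc k)) A = (\<integral>\<^sup>+s. indicator A s \<partial>P (Suc k))"
      using A sets_P Suc by simp
    also have "\<dots> = (\<integral>\<^sup>+s. \<integral>\<^sup>+v. indicator A (upd k s v) \<partial>K k s \<partial>P k)"
      by (rule nn_integral_Suc[OF k]) measurable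
    also have "\<dots> = (\<integral>\<^sup>+u. \<integral>\<^sup>+v. indicator A (upd k (Z k u) v) \<partial>K k (Z k u) \<partial>unit_cube k)"
      using Suc Z[of k] by (simp add: nn_integral_distr)
    also have "\<dots> = (\<integral>\<^sup>+u. \<integral>\<^sup>+t. indicator A (Z (Suc k) (u(k := t))) \<partial>unit_itv \<partial>unit_cube k)"
    proof (intro nn_integral_cong)
      fix u assume u: "u \<in> space (unit_cube k)"
      then have s[measurable]: "Z k u \<in> space (S k)"
        using measurable_space[OF Z[of k]] k by simp
      have "upd k (Z k u) \<in> V \<rightarrow>\<^sub>M S (Suc k)" by measurable
      then have "(\<lambda>v. indicator A (upd k (Z k u) v) :: ennreal) \<in> borel_measurable V" by measurable
      then have "(\<integral>\<^sup>+v. indicator A (upd k (Z k u) v) \<partial>K k (Z k u))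
          = (\<integral>\<^sup>+t. indicator A (upd k (Z k u) (g k (Z k u) t)) \<partial>unit_itv)"
        unfolding K[OF k s] by (intro nn_integral_distr g k s) simp
      also have "\<dots> = (\<integral>\<^sup>+t. indicator A (Z (Suc k) (u(k := t))) \<partial>unit_itv)"
        by (intro nn_integral_cong) (simp add: Z_Suc[OF k u])
      finally show "(\<integral>\<^sup>+v. indicator A (upd k (Z k u) v) \<partial>K k (Z k u))
          = (\<integral>\<^sup>+t. indicator A (Z (Suc k) (u(k := t))) \<partial>unit_itv)" .
    qed
    also have "\<dots> = (\<integral>\<^sup>+w. indicator A (Z (Suc k) w) \<partial>unit_cube (Suc k))"
      using Suc by (intro nn_integral_unit_cube_Suc[symmetric]) measurable
    also have "\<dots> = (\<integral>\<^sup>+w. indicator A w \<partial>distr (unit_cube (Suc k)) (S (Suc k)) (Z (Suc k)))"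
      using Suc by (subst nn_integral_distr) auto
    finally show "emeasure (P (Suc k)) A = emeasure (distr (unit_cube (Suc k)) (S (Suc k)) (Z (Suc k))) A"
      by simp
  qed
qed

end

section \<open>Quantile processes as compositions of monotone transports\<close>

text \<open>\<open>H k x\<close> acts as the quantile function of step \<open>k\<close> at the past
  \<open>x\<close>. Only coordinates of \<open>u\<close> below the index are read, so the same map
  lives on every larger cube; the starting value is the only point of \<open>RN 0\<close>.\<close>

primrec composed :: "(nat \<Rightarrow> (nat \<Rightarrow> real) \<Rightarrow> real \<Rightarrow> real) \<Rightarrow> nat \<Rightarrow> (nat \<Rightarrow> real) \<Rightarrow> nat \<Rightarrow> real" where
  "composed H 0 u = (\<lambda>_. undefined)"
| "composed H (Suc k) u = (composed H k u)(k := H k (composed H k u) (u k))"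

text \<open>Joint measurability is what makes the compositions measurable. Up to its values at
  jumps, a monotone \<open>H k x\<close> is the quantile function of the law to which it pushes the
  uniform law.\<close>

definition monotone_transport :: "nat \<Rightarrow> (nat \<Rightarrow> (nat \<Rightarrow> real) \<Rightarrow> real \<Rightarrow> real) \<Rightarrow> bool" where
  "monotone_transport N H \<longleftrightarrow> (\<forall>k<N. (\<lambda>(x, t). H k x t) \<in> borel_measurable (RN k \<Otimes>\<^sub>M unit_itv) \<and>
     (\<forall>x\<in>space (RN k). mono_on {0<..<1} (H k x)))"

lemma composed_nth: "i < n \<Longrightarrow> composed H n u i = H i (composed H i u) (u i)"
  by (induction n) (auto simp: less_Suc_eq)

lemma composed_cong: "(\<And>i. i < n \<Longrightarrow> u i = v i) \<Longrightarrow> composed H n u = composed H n v"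
  by (induction n) auto

lemma measurable_RN_upd [measurable]: "(\<lambda>(x, a). x(k := a)) \<in> RN k \<Otimes>\<^sub>M borel \<rightarrow>\<^sub>M RN (Suc k)"
  unfolding lessThan_Suc by (rule measurable_add_dim)

lemma measurable_unit_cube_nth: "k < n \<Longrightarrow> (\<lambda>u. u k) \<in> unit_cube n \<rightarrow>\<^sub>M unit_itv"
  unfolding unit_cube_def by (rule measurable_component_singleton) simp

lemma measurable_composed:
  assumes "monotone_transport N H" "k \<le> N" "k \<le> n"
  shows "composed H k \<in> unit_cube n \<rightarrow>\<^sub>M RN k"
  using assms(2,3)
proof (induction k)
  case 0
  then show ?case by (auto intro!: measurable_const simp: space_PiM)
next
  case (Suc k)
  then have [measurable]: "composed H k \<in> unit_cube n \<rightarrow>\<^sub>M RN k"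
    "(\<lambda>u. u k) \<in> unit_cube n \<rightarrow>\<^sub>M unit_itv"
    "(\<lambda>(x, t). H k x t) \<in> borel_measurable (RN k \<Otimes>\<^sub>M unit_itv)"
    using assms(1) by (auto intro: measurable_unit_cube_nth simp: monotone_transport_def)
  show ?case unfolding composed.simps by measurable
qed

lemma composed_in_RN:
  assumes "monotone_transport N H" "k \<le> N" "u \<in> space (unit_cube N)"
  shows "composed H k u \<in> space (RN k)"
  using measurable_composed[OF assms(1,2,2)] assms(3) by (rule measurable_space)

lemma unit_cube_upd: "u \<in> space (unit_cube N) \<Longrightarrow> k < N \<Longrightarrow> t \<in> {0<..<1} \<Longrightarrow> u(k := t) \<in> space (unit_cube N)"
  unfolding space_unit_cube by (auto simp: PiE_iff extensional_def)

lemma unit_cube_nth: "u \<in> space (unit_cube N) \<Longrightarrow> k < N \<Longrightarrow> u k \<in> {0<..<1}"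
  unfolding space_unit_cube by (auto simp: PiE_iff)

text \<open>Condition (inc) is monotonicity of \<open>H k\<close> at a past that does not involve
  \<open>u k\<close>. Condition (con) holds since \<open>u k\<close> enters later coordinates only
  through the value of coordinate \<open>k\<close>: if that value is unchanged, so are all states
  from \<open>Suc k\<close> on.\<close>

lemma quantile_process_composed:
  assumes H: "monotone_transport N H"
  shows "quantile_process N (composed H N)"
  unfolding quantile_process_def
proof (intro conjI allI ballI impI)
  show "composed H N \<in> unit_cube N \<rightarrow>\<^sub>M RN N"
    using H by (rule measurable_composed) auto
next
  fix k and u v :: "nat \<Rightarrow> real" assume "k < N" "\<forall>i\<le>k. u i = v i"
  then show "composed H N u k = composed H N v k"
    by (simp add: composed_nth composed_cong[of k u v])
next
  fix k u t assume k: "k < N" and u: "u \<in> space (unit_cube N)" and t: "t \<in> {0<..<1}" and le: "u k \<le> t"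
  have "composed H k (u(k := t)) = composed H k u" by (rule composed_cong) auto
  then show "composed H N u k \<le> composed H N (u(k := t)) k"
    using H composed_in_RN[OF H _ u, of k] unit_cube_nth[OF u k] t le k
    by (auto simp: composed_nth monotone_transport_def mono_on_def)
next
  fix m k and u :: "nat \<Rightarrow> real" and t :: real
  assume m: "m < N" and "k \<le> m" and eq: "composed H N u k = composed H N (u(k := t)) k"
  have *: "composed H k (u(k := t)) = composed H k u" by (rule composed_cong) auto
  have "composed H j (u(k := t)) = composed H j u" if "Suc k \<le> j" for j
    using that
  proof (induction j rule: dec_induct)
    case base
    have "H k (composed H k u) t = H k (composed H k u) (u k)"
      using eq m \<open>k \<le> m\<close> * by (simp add: composed_nth)
    then show ?case by (simp only: composed.simps * fun_upd_same)
  next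
    case (step j)
    then show ?case by (simp only: composed.simps) simp
  qed
  then show "composed H N u m = composed H N (u(k := t)) m"
    using eq m \<open>k \<le> m\<close> by (cases "k = m") (auto simp: composed_nth)
qed

text \<open>For monotone \<open>h\<close> the level set \<open>{h = y}\<close> is an interval; its midpoint is measurable in \<open>y\<close>
  and in parameters of \<open>h\<close>.\<close>

definition level_midpoint :: "(real \<Rightarrow> real) \<Rightarrow> real \<Rightarrow> real" where
  "level_midpoint h y =
     (measure unit_itv {t\<in>{0<..<1}. h t < y} + measure unit_itv {t\<in>{0<..<1}. h t \<le> y}) / 2"

text \<open>Sublevel sets of a monotone function are initial intervals, so the two measures are the
  end points of the level interval around \<open>s\<close>. An end point may fall outside the level
  set; the midpoint lies strictly inside, or equals \<open>s\<close> when the interval is a single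
  point.\<close>

lemma level_midpoint:
  fixes h :: "real \<Rightarrow> real"
  assumes h: "mono_on {0<..<1} h" and s: "s \<in> {0<..<1}"
  shows "level_midpoint h (h s) \<in> {0<..<1}" "h (level_midpoint h (h s)) = h s"
proof -
  note [measurable] = measurable_mono_unit_itv[OF h]
  let ?A = "{t\<in>{0<..<1}. h t < h s}" and ?B = "{t\<in>{0<..<1}. h t \<le> h s}"
  define m where "m = level_midpoint h (h s)"
  have "?A = {t\<in>space unit_itv. h t < h s}" "?B = {t\<in>space unit_itv. h t \<le> h s}" by auto
  then have sets: "?A \<in> sets unit_itv" "?B \<in> sets unit_itv" by (simp_all only:) measurable
  have len: "measure unit_itv {0<..<c} = c" "measure unit_itv {0<..c} = c"
    and itv: "{0<..<c} \<in> sets unit_itv" "{0<..c} \<in> sets unit_itv"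
    if "0 \<le> c" "c < 1" for c :: real
  proof -
    have "{0<..<c} \<subseteq> {0<..<1}" "{0<..c} \<subseteq> {0<..<1}" using that by auto
    with that show "measure unit_itv {0<..<c} = c" "measure unit_itv {0<..c} = c"
      "{0<..<c} \<in> sets unit_itv" "{0<..c} \<in> sets unit_itv"
      by (simp_all add: measure_restrict_space sets_restrict_space_iff)
  qed
  have mono: "h a \<le> h b" if "a \<in> {0<..<1}" "b \<in> {0<..<1}" "a \<le> b" for a b
    using h that by (auto simp: mono_on_def)
  have below: "measure unit_itv ?A \<le> c" if "c \<in> {0<..<1}" "h s \<le> h c" for c
  proof -
    have "?A \<subseteq> {0<..<c}"
    proof
      fix t assume t: "t \<in> ?A"
      then have "\<not> c \<le> t" using mono[OF that(1), of t] that by auto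
      then show "t \<in> {0<..<c}" using t by simp
    qed
    then show ?thesis using unit_itv.finite_measure_mono[OF _ itv(1)[of c]] that len(1)[of c] by simp
  qed
  have above: "c \<le> measure unit_itv ?B" if "c \<in> {0<..<1}" "h c \<le> h s" for c
  proof -
    have "{0<..c} \<subseteq> ?B"
    proof
      fix t assume t: "t \<in> {0<..c}"
      then show "t \<in> ?B" using mono[OF _ that(1), of t] that by auto
    qed
    then show ?thesis using unit_itv.finite_measure_mono[OF _ sets(2), of "{0<..c}"] that len(2)[of c] by simp
  qed
  have strict_below: "c \<le> measure unit_itv ?A" if "c \<in> {0<..<1}" "h c < h s" for c
  proof -
    have "{0<..c} \<subseteq> ?A"
    proof
      fix t assume t: "t \<in> {0<..c}"
      then show "t \<in> ?A" using mono[OF _ that(1), of t] that by auto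
    qed
    then show ?thesis using unit_itv.finite_measure_mono[OF _ sets(1), of "{0<..c}"] that len(2)[of c] by simp
  qed
  have strict_above: "measure unit_itv ?B \<le> c" if "c \<in> {0<..<1}" "h s < h c" for c
  proof -
    have "?B \<subseteq> {0<..<c}"
    proof
      fix t assume t: "t \<in> ?B"
      then have "\<not> c \<le> t" using mono[OF that(1), of t] that by auto
      then show "t \<in> {0<..<c}" using t by simp
    qed
    then show ?thesis using unit_itv.finite_measure_mono[OF _ itv(1)[of c]] that len(1)[of c] by simp
  qed
  have m: "2 * m = measure unit_itv ?A + measure unit_itv ?B"
    by (simp add: m_def level_midpoint_def)
  have a: "measure unit_itv ?A \<le> s" "s \<le> measure unit_itv ?B" using below above s by auto
  have m01: "m \<in> {0<..<1}"
    unfolding greaterThanLessThan_iff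
    using m a s[unfolded greaterThanLessThan_iff] measure_nonneg[of unit_itv ?A] unit_itv.prob_le_1[of ?B]
    by (intro conjI; linarith)
  have "h m = h s"
  proof (rule antisym)
    show "h m \<le> h s"
    proof (rule ccontr)
      assume "\<not> h m \<le> h s"
      \<comment> \<open>Now \<open>m\<close> is at or beyond the upper end, while the lower end is
        at most \<open>s < m\<close>: this contradicts \<open>m\<close> being the mean of the two
        ends. The other inequality is symmetric.\<close>
      then have "measure unit_itv ?B \<le> m" "s < m"
        using strict_above[OF m01] mono[OF m01 s] by (simp, meson not_le)
      then show False using m a by linarith
    qed
    show "h s \<le> h m"
    proof (rule ccontr)
      assume "\<not> h s \<le> h m"
      then have "m \<le> measure unit_itv ?A" "m < s"
        using strict_below[OF m01] mono[OF s m01] by (simp, meson not_le)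
      then show False using m a by linarith
    qed
  qed
  with m01 show "level_midpoint h (h s) \<in> {0<..<1}" "h (level_midpoint h (h s)) = h s"
    by (auto simp: m_def)
qed

text \<open>The two masses are those of sections of sets that are measurable in the product, hence
  measurable in the parameter.\<close>

lemma measurable_level_midpoint:
  assumes h[measurable]: "(\<lambda>(x, t). h x t) \<in> borel_measurable (M \<Otimes>\<^sub>M unit_itv)"
    and y[measurable]: "y \<in> borel_measurable M"
  shows "(\<lambda>x. level_midpoint (h x) (y x)) \<in> borel_measurable M"
proof -
  have [measurable]: "(\<lambda>z. y (fst z)) \<in> borel_measurable (M \<Otimes>\<^sub>M unit_itv)"
    "(\<lambda>z. h (fst z) (snd z)) \<in> borel_measurable (M \<Otimes>\<^sub>M unit_itv)"
    using h by (auto simp: case_prod_unfold intro: measurable_compose[OF measurable_fst y])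
  have sets: "{z\<in>space (M \<Otimes>\<^sub>M unit_itv). h (fst z) (snd z) < y (fst z)} \<in> sets (M \<Otimes>\<^sub>M unit_itv)"
    "{z\<in>space (M \<Otimes>\<^sub>M unit_itv). h (fst z) (snd z) \<le> y (fst z)} \<in> sets (M \<Otimes>\<^sub>M unit_itv)"
    by measurable
  have "(\<lambda>x. (measure unit_itv (Pair x -` {z\<in>space (M \<Otimes>\<^sub>M unit_itv). h (fst z) (snd z) < y (fst z)})
      + measure unit_itv (Pair x -` {z\<in>space (M \<Otimes>\<^sub>M unit_itv). h (fst z) (snd z) \<le> y (fst z)})) / 2)
    \<in> borel_measurable M"
    using unit_itv.measurable_emeasure_Pair[OF sets(1)] unit_itv.measurable_emeasure_Pair[OF sets(2)]
    unfolding measure_def by measurable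
  also have "?this \<longleftrightarrow> ?thesis"
    unfolding level_midpoint_def
    by (intro measurable_cong arg_cong2[where f="(/)"] arg_cong2[where f="(+)"] arg_cong[where f="measure unit_itv"])
       (auto simp: space_pair_measure)
  finally show ?thesis .
qed

section \<open>How a quantile process depends on its past\<close>

lemma quantile_process_measurable: "quantile_process N Q \<Longrightarrow> Q \<in> unit_cube N \<rightarrow>\<^sub>M RN N"
  unfolding quantile_process_def by (elim conjE)

lemma quantile_process_triangular:
  assumes Q: "quantile_process N Q" and k: "k < N" and u: "u \<in> space (unit_cube N)"
    and v: "v \<in> space (unit_cube N)" and eq: "\<And>i. i \<le> k \<Longrightarrow> u i = v i"
  shows "Q u k = Q v k"
proof -
  have "\<forall>k<N. \<forall>u\<in>space (unit_cube N). \<forall>v\<in>space (unit_cube N). (\<forall>i\<le>k. u i = v i) \<longrightarrow> Q u k = Q v k"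
    using Q unfolding quantile_process_def by (elim conjE)
  from this[rule_format, OF k u v eq] show ?thesis .
qed

lemma quantile_process_inc:
  assumes Q: "quantile_process N Q" and k: "k < N" and u: "u \<in> space (unit_cube N)"
    and t: "t \<in> {0<..<1}" and le: "u k \<le> t"
  shows "Q u k \<le> Q (u(k := t)) k"
proof -
  have "\<forall>k<N. \<forall>u\<in>space (unit_cube N). \<forall>t\<in>{0<..<1}. u k \<le> t \<longrightarrow> Q u k \<le> Q (u(k := t)) k"
    using Q unfolding quantile_process_def by (elim conjE)
  from this[rule_format, OF k u t le] show ?thesis .
qed

lemma quantile_process_con:
  assumes Q: "quantile_process N Q" and m: "m < N" and k: "k \<le> m" and u: "u \<in> space (unit_cube N)"
    and t: "t \<in> {0<..<1}" and le: "u k \<le> t" and eq: "Q u k = Q (u(k := t)) k"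
  shows "Q u m = Q (u(k := t)) m"
proof -
  have "\<forall>m<N. \<forall>k\<le>m. \<forall>u\<in>space (unit_cube N). \<forall>t\<in>{0<..<1}.
      u k \<le> t \<longrightarrow> Q u k = Q (u(k := t)) k \<longrightarrow> Q u m = Q (u(k := t)) m"
    using Q unfolding quantile_process_def by (elim conjE)
  from this[rule_format, OF m k u t le eq] show ?thesis .
qed

text \<open>The past arguments are exchanged one at a time, from the highest index down. Exchanging
  one of them leaves all values of the process unchanged by triangularity below it and by (con) from
  it on.\<close>

lemma quantile_process_determined:
  assumes Q: "quantile_process N Q" and "k \<le> N"
    and "u \<in> space (unit_cube N)" "v \<in> space (unit_cube N)"
    and "\<And>i. i < k \<Longrightarrow> Q u i = Q v i" and "\<And>i. k \<le> i \<Longrightarrow> u i = v i" and "m < N"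
  shows "Q u m = Q v m"
  using assms(2-)
proof (induction k arbitrary: v m)
  case 0
  then have "u = v" by auto
  then show ?case by simp
next
  case (Suc k)
  note tri = quantile_process_triangular[OF Q]
  note con = quantile_process_con[OF Q Suc.prems(6)]
  define w where "w = v(k := u k)"
  have w: "w \<in> space (unit_cube N)" unfolding w_def
    using Suc.prems by (intro unit_cube_upd unit_cube_nth[of u N]) auto
  have vw: "Q v i = Q w i" if "i < k" for i
    using that Suc.prems w by (intro tri) (auto simp: w_def)
  have IH: "Q u j = Q w j" if "j < N" for j
  proof (rule Suc.IH)
    show "u i = w i" if "k \<le> i" for i
      using that Suc.prems(5)[of i] by (cases "i = k") (auto simp: w_def)
    show "Q u i = Q w i" if "i < k" for i
      using that Suc.prems(4)[of i] vw[of i] by simp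
  qed (use Suc.prems w that in auto)
  \<comment> \<open>The induction hypothesis, applied to \<open>u\<close> and \<open>w\<close>,
    supplies the premise of (con) for \<open>v\<close> and \<open>w\<close>, which differ in
    coordinate \<open>k\<close> only.\<close>
  have eqk: "Q v k = Q w k" using IH[of k] Suc.prems(1) Suc.prems(4)[of k] by simp
  have "Q v m = Q w m"
  proof (cases "k \<le> m")
    case True
    \<comment> \<open>(con) moves a coordinate upwards only. As \<open>w\<close> is an update of
      \<open>v\<close> and \<open>v\<close> one of \<open>w\<close>, both orders of
      \<open>u k\<close> and \<open>v k\<close> are covered.\<close>
    have vw_k: "w(k := v k) = v" "w k = u k" by (auto simp: w_def)
    have "u k \<in> {0<..<1}" "v k \<in> {0<..<1}"
      using Suc.prems(1-3) by (auto intro: unit_cube_nth simp del: greaterThanLessThan_iff)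
    then show ?thesis
      using con[of k v "u k", folded w_def] con[of k w "v k", unfolded vw_k] True Suc.prems(3) w eqk
      by (cases "v k \<le> u k") simp_all
  next
    case False
    then show ?thesis using Suc.prems w by (intro tri) (auto simp: w_def)
  qed
  then show ?case using IH[OF \<open>m < N\<close>] by simp
qed

text \<open>A measurable section: \<open>process_section N Q k x\<close> is a point of the cube at which the first
  \<open>k\<close> coordinates of the process are \<open>x\<close>, whenever \<open>x\<close> is attained at all.\<close>

primrec process_section ::
  "nat \<Rightarrow> ((nat \<Rightarrow> real) \<Rightarrow> (nat \<Rightarrow> real)) \<Rightarrow> nat \<Rightarrow> (nat \<Rightarrow> real) \<Rightarrow> nat \<Rightarrow> real" where
  "process_section N Q 0 x = (\<lambda>i\<in>{..<N}. 1 / 2)"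
| "process_section N Q (Suc k) x =
     (let v = process_section N Q k (restrict x {..<k}); m = level_midpoint (\<lambda>t. Q (v(k := t)) k) (x k)
      in v(k := if 0 < m \<and> m < 1 then m else 1 / 2))"

text \<open>The function \<open>H\<^sub>k\<close> belonging to a given process: the past arguments
  are replaced by a representative point of the cube with the prescribed past values.\<close>

definition process_transport ::
  "nat \<Rightarrow> ((nat \<Rightarrow> real) \<Rightarrow> (nat \<Rightarrow> real)) \<Rightarrow> nat \<Rightarrow> (nat \<Rightarrow> real) \<Rightarrow> real \<Rightarrow> real" where
  "process_transport N Q k x t = Q ((process_section N Q k x)(k := t)) k"

lemma process_section_Suc:
  "process_section N Q (Suc k) x =
     (process_section N Q k (restrict x {..<k}))(k :=
       if 0 < level_midpoint (process_transport N Q k (restrict x {..<k})) (x k) \<and>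
          level_midpoint (process_transport N Q k (restrict x {..<k})) (x k) < 1
       then level_midpoint (process_transport N Q k (restrict x {..<k})) (x k) else 1 / 2)"
  by (simp add: Let_def process_transport_def[abs_def])

lemma measurable_unit_cube_upd':
  assumes "k < N"
  shows "(\<lambda>(u, t). u(k := t)) \<in> unit_cube N \<Otimes>\<^sub>M unit_itv \<rightarrow>\<^sub>M unit_cube N"
proof -
  have "insert k {..<N} = {..<N}" using assms by auto
  then show ?thesis unfolding unit_cube_def
    using measurable_add_dim[of k "{..<N}" "\<lambda>_. unit_itv"] by simp
qed

text \<open>The two facts alternate: a measurable section at \<open>k\<close> gives a measurable
  transport at \<open>k\<close>, and the level midpoint of that transport extends the section by one
  coordinate.\<close>

lemma
  assumes Q: "quantile_process N Q" and "k \<le> N"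
  shows measurable_process_section: "process_section N Q k \<in> RN k \<rightarrow>\<^sub>M unit_cube N"
    and measurable_process_transport: "k < N \<Longrightarrow>
      (\<lambda>(x, t). process_transport N Q k x t) \<in> borel_measurable (RN k \<Otimes>\<^sub>M unit_itv)"
proof -
  have Q_meas[measurable]: "Q \<in> unit_cube N \<rightarrow>\<^sub>M RN N" using Q by (rule quantile_process_measurable)
  have step: "(\<lambda>(x, t). process_transport N Q k x t) \<in> borel_measurable (RN k \<Otimes>\<^sub>M unit_itv)"
    if "k < N" and [measurable]: "process_section N Q k \<in> RN k \<rightarrow>\<^sub>M unit_cube N" for k
  proof -
    note [measurable] = measurable_unit_cube_upd'[OF \<open>k < N\<close>]
    have [measurable]: "(\<lambda>u. Q u k) \<in> borel_measurable (unit_cube N)"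
      using measurable_compose[OF Q_meas measurable_component_singleton[of k "{..<N}"]] \<open>k < N\<close> by simp
    show ?thesis unfolding process_transport_def by measurable
  qed
  show 1: "process_section N Q k \<in> RN k \<rightarrow>\<^sub>M unit_cube N"
    using \<open>k \<le> N\<close>
  proof (induction k)
    case 0
    have "(\<lambda>i\<in>{..<N}. 1 / 2) \<in> space (unit_cube N)" by (simp add: space_unit_cube)
    then have "(\<lambda>x. process_section N Q 0 x) \<in> RN 0 \<rightarrow>\<^sub>M unit_cube N"
      by (simp only: process_section.simps measurable_const)
    then show ?case .
  next
    case (Suc k)
    then have k: "k < N" and [measurable]: "process_section N Q k \<in> RN k \<rightarrow>\<^sub>M unit_cube N" by auto
    note [measurable] = measurable_unit_cube_upd'[OF k] step[OF k this(2)]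
    have [measurable]: "(\<lambda>x. restrict x {..<k}) \<in> RN (Suc k) \<rightarrow>\<^sub>M RN k"
      by (rule measurable_restrict_subset) auto
    have [measurable]: "(\<lambda>x. x k) \<in> borel_measurable (RN (Suc k))"
      by (rule measurable_component_singleton) simp
    have "(\<lambda>x. level_midpoint (process_transport N Q k (restrict x {..<k})) (x k)) \<in> borel_measurable (RN (Suc k))"
      by (rule measurable_level_midpoint) measurable
    \<comment> \<open>The fallback \<open>1 / 2\<close> keeps the section in the open cube also at
      points \<open>x\<close> that the process does not attain.\<close>
    then have [measurable]: "(\<lambda>x. if 0 < level_midpoint (process_transport N Q k (restrict x {..<k})) (x k) \<and>
        level_midpoint (process_transport N Q k (restrict x {..<k})) (x k) < 1
      then level_midpoint (process_transport N Q k (restrict x {..<k})) (x k) else 1 / 2) \<in> RN (Suc k) \<rightarrow>\<^sub>M unit_itv"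
      by (intro measurable_restrict_space2) (auto simp: measurable_lborel1)
    have "(\<lambda>x. process_section N Q (Suc k) x) \<in> RN (Suc k) \<rightarrow>\<^sub>M unit_cube N"
      unfolding process_section_Suc by measurable
    then show ?case .
  qed
  show "k < N \<Longrightarrow> (\<lambda>(x, t). process_transport N Q k x t) \<in> borel_measurable (RN k \<Otimes>\<^sub>M unit_itv)"
    by (rule step[OF _ 1])
qed

lemma mono_process_transport:
  assumes Q: "quantile_process N Q" and k: "k < N" and x: "x \<in> space (RN k)"
  shows "mono_on {0<..<1} (process_transport N Q k x)"
proof (rule mono_onI)
  fix s t :: real assume st: "s \<in> {0<..<1}" "t \<in> {0<..<1}" "s \<le> t"
  let ?v = "process_section N Q k x"
  have "?v \<in> space (unit_cube N)"
    using measurable_process_section[OF Q] k x by (auto intro: measurable_space)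
  then have v: "?v(k := s) \<in> space (unit_cube N)" using k st by (intro unit_cube_upd)
  from quantile_process_inc[OF Q k v st(2)] st
  show "process_transport N Q k x s \<le> process_transport N Q k x t"
    by (simp add: process_transport_def)
qed

text \<open>The section recovers the past values of the process, not the past arguments; by
  \<open>quantile_process_determined\<close> the values suffice to reproduce coordinate
  \<open>k\<close>. The level midpoint then picks a new argument with the same value, which
  continues the induction.\<close>

lemma
  assumes Q: "quantile_process N Q" and u: "u \<in> space (unit_cube N)" and "k \<le> N"
  shows process_section: "i < k \<Longrightarrow> Q (process_section N Q k (restrict (Q u) {..<k})) i = Q u i"
    and process_transport: "k < N \<Longrightarrow> process_transport N Q k (restrict (Q u) {..<k}) (u k) = Q u k"
proof -
  note tri = quantile_process_triangular[OF Q]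
  have rQ: "restrict (Q u) {..<k} \<in> space (RN k)" if "k \<le> N" for k
    by (simp add: space_PiM)
  have sect: "process_section N Q k (restrict (Q u) {..<k}) \<in> space (unit_cube N)" if "k \<le> N" for k
    using measurable_process_section[OF Q that] rQ[OF that] by (rule measurable_space)
  have step: "process_transport N Q k (restrict (Q u) {..<k}) (u k) = Q u k"
    if k: "k < N" and IH: "\<And>i. i < k \<Longrightarrow> Q (process_section N Q k (restrict (Q u) {..<k})) i = Q u i" for k
  proof -
    define v where "v = process_section N Q k (restrict (Q u) {..<k})"
    have v: "v \<in> space (unit_cube N)" using sect k by (simp add: v_def)
    define v' where "v' = v(k := u k)"
    have v': "v' \<in> space (unit_cube N)" unfolding v'_def
      using v k unit_cube_nth[OF u k] by (rule unit_cube_upd)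
    \<comment> \<open>\<open>u'\<close> follows \<open>u\<close> up to \<open>k\<close> and the
      section afterwards. So it agrees with \<open>v'\<close> from \<open>k\<close> on, as
      \<open>quantile_process_determined\<close> demands, and triangularity identifies coordinate
      \<open>k\<close> of the process at \<open>u'\<close> with that at \<open>u\<close>.\<close>
    define u' where "u' i = (if i \<le> k then u i else v' i)" for i
    have u': "u' \<in> space (unit_cube N)"
      using u v' k by (auto simp: u'_def space_unit_cube PiE_iff extensional_def)
    have "Q u' k = Q v' k"
    proof (rule quantile_process_determined[OF Q _ u' v'])
      show "Q u' i = Q v' i" if "i < k" for i
      proof -
        have "Q u' i = Q u i" using that k u u' by (intro tri) (auto simp: u'_def)
        also have "\<dots> = Q v i" using IH[OF that] by (simp add: v_def)
        also have "\<dots> = Q v' i" using that k v v' by (intro tri) (auto simp: v'_def)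
        finally show ?thesis .
      qed
    qed (use k in \<open>auto simp: u'_def v'_def\<close>)
    moreover have "Q u' k = Q u k" using k u u' by (intro tri) (auto simp: u'_def)
    ultimately show ?thesis by (simp add: process_transport_def v_def v'_def)
  qed
  have *: "\<forall>i<k. Q (process_section N Q k (restrict (Q u) {..<k})) i = Q u i" if "k \<le> N" for k
    using that
  proof (induction k)
    case (Suc k)
    then have k: "k < N" by simp
    let ?x = "restrict (Q u) {..<k}"
    define v where "v = process_section N Q k ?x"
    have v: "v \<in> space (unit_cube N)" using sect k by (simp add: v_def)
    define m where "m = level_midpoint (process_transport N Q k ?x) (Q u k)"
    have IH: "Q v i = Q u i" if "i < k" for i
      using Suc.IH[OF less_imp_le[OF k]] that unfolding v_def by blast
    then have h: "process_transport N Q k ?x (u k) = Q u k" using step k by (simp add: v_def)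
    have m: "m \<in> {0<..<1}" "process_transport N Q k ?x m = Q u k"
      using level_midpoint[OF mono_process_transport[OF Q k rQ] unit_cube_nth[OF u k]] k
      by (simp_all add: m_def h)
    have eq: "process_section N Q (Suc k) (restrict (Q u) {..<Suc k}) = v(k := m)"
    proof -
      have "restrict (restrict (Q u) {..<Suc k}) {..<k} = ?x" by (auto simp: fun_eq_iff)
      moreover have "restrict (Q u) {..<Suc k} k = Q u k" by simp
      ultimately show ?thesis using m(1) unfolding process_section_Suc m_def v_def by simp
    qed
    have vm: "v(k := m) \<in> space (unit_cube N)" using v k m(1) by (rule unit_cube_upd)
    show ?case unfolding eq
    proof (intro allI impI)
      fix i assume "i < Suc k"
      then consider "i < k" | "i = k" by linarith
      then show "Q (v(k := m)) i = Q u i"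
      proof cases
        case 1
        then have "Q (v(k := m)) i = Q v i" using k v vm by (intro tri) auto
        then show ?thesis using IH[OF 1] by simp
      next
        case 2
        then show ?thesis using m(2) by (simp add: process_transport_def v_def)
      qed
    qed
  qed simp
  show "i < k \<Longrightarrow> Q (process_section N Q k (restrict (Q u) {..<k})) i = Q u i"
    using *[OF \<open>k \<le> N\<close>] by simp
  show "k < N \<Longrightarrow> process_transport N Q k (restrict (Q u) {..<k}) (u k) = Q u k"
    using *[OF \<open>k \<le> N\<close>] by (intro step) auto
qed

text \<open>Recursion over the coordinates with \<open>process_transport\<close> in the role of
  \<open>H\<close>. The representation holds at every point of the cube, hence for whichever process
  the choice in \<open>the_quantile_process\<close> selects.\<close>

lemma quantile_process_eq_composed:
  assumes Q: "quantile_process N Q"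
  obtains H where "monotone_transport N H" "\<And>u. u \<in> space (unit_cube N) \<Longrightarrow> Q u = composed H N u"
proof
  show "monotone_transport N (process_transport N Q)"
    using measurable_process_transport[OF Q] mono_process_transport[OF Q]
    by (auto simp: monotone_transport_def)
  fix u assume u: "u \<in> space (unit_cube N)"
  have "restrict (Q u) {..<k} = composed (process_transport N Q) k u" if "k \<le> N" for k
    using that
  proof (induction k)
    case (Suc k)
    have "restrict (Q u) {..<Suc k} = (restrict (Q u) {..<k})(k := Q u k)" by (auto simp: fun_eq_iff)
    moreover have "restrict (Q u) {..<k} = composed (process_transport N Q) k u"
      by (rule Suc.IH) (use Suc.prems in simp)
    moreover from this have "process_transport N Q k (composed (process_transport N Q) k u) (u k) = Q u k"
      using Suc.prems process_transport[OF Q u, of k] by (simp only: Suc_le_eq less_imp_le)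
    ultimately show ?case by (simp only: composed.simps)
  qed auto
  from this[of N] show "Q u = composed (process_transport N Q) N u"
    using measurable_space[OF quantile_process_measurable[OF Q] u]
    by (simp add: space_PiM PiE_iff extensional_restrict)
qed

section \<open>Transports from given kernels\<close>

text \<open>The generalised inverses of the distribution functions serve. By their Galois connection
  \<open>H k x t \<le> s\<close> means \<open>t \<le> cdf (\<kappa> k x) s\<close>, a condition that
  is measurable jointly in \<open>x\<close> and \<open>t\<close>.\<close>

lemma monotone_transport_of_kernels:
  assumes \<kappa>: "\<And>k. k < N \<Longrightarrow> \<kappa> k \<in> RN k \<rightarrow>\<^sub>M prob_algebra borel"
  obtains H where "monotone_transport N H"
    "\<And>k x. k < N \<Longrightarrow> x \<in> space (RN k) \<Longrightarrow> distr unit_itv borel (H k x) = \<kappa> k x"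
proof
  define H where "H k x t = Inf {s. t \<le> cdf (\<kappa> k x) s}" for k x t
  have real: "cdf_distribution (\<kappa> k x)" if "k < N" "x \<in> space (RN k)" for k x
  proof -
    have "\<kappa> k x \<in> space (prob_algebra borel)" using \<kappa>[OF that(1)] that(2) by (rule measurable_space)
    then show ?thesis
      by (auto simp: cdf_distribution_def real_distribution_def real_distribution_axioms_def space_prob_algebra)
  qed
  show "distr unit_itv borel (H k x) = \<kappa> k x" if "k < N" "x \<in> space (RN k)" for k x
    using cdf_distribution.distr_I_eq_M[OF real[OF that]] by (simp add: H_def[abs_def])
  show "monotone_transport N H"
    unfolding monotone_transport_def
  proof (intro allI impI conjI ballI)
    fix k x assume "k < N" "x \<in> space (RN k)"
    then interpret cdf_distribution "\<kappa> k x" by (rule real)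
    show "mono_on {0<..<1} (H k x)" using mono_I by (simp add: H_def[abs_def])
  next
    fix k assume k: "k < N"
    have [measurable]: "\<kappa> k \<in> RN k \<rightarrow>\<^sub>M prob_algebra borel" using \<kappa>[OF k] .
    show "(\<lambda>(x, t). H k x t) \<in> borel_measurable (RN k \<Otimes>\<^sub>M unit_itv)"
    proof (rule borel_measurable_iff_le[THEN iffD2], rule allI)
      fix s :: real
      have [measurable]: "(\<lambda>z. snd z) \<in> borel_measurable (RN k \<Otimes>\<^sub>M unit_itv)"
        by (rule measurable_compose[OF measurable_snd]) (simp add: measurable_restrict_space1)
      have [measurable]: "(\<lambda>x. measure (\<kappa> k x) {..s}) \<in> borel_measurable (RN k)" by measurable
      have "{z\<in>space (RN k \<Otimes>\<^sub>M unit_itv). (case z of (x, t) \<Rightarrow> H k x t) \<le> s}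
          = {z\<in>space (RN k \<Otimes>\<^sub>M unit_itv). snd z \<le> measure (\<kappa> k (fst z)) {..s}}"
      proof -
        have "H k x t \<le> s \<longleftrightarrow> t \<le> measure (\<kappa> k x) {..s}" if "x \<in> space (RN k)" "t \<in> {0<..<1}" for x t
        proof -
          interpret cdf_distribution "\<kappa> k x" using k that by (intro real)
          show ?thesis using pseudoinverse[of t s] that by (simp add: H_def cdf_def)
        qed
        then show ?thesis by (auto simp: space_pair_measure)
      qed
      also have "\<dots> \<in> sets (RN k \<Otimes>\<^sub>M unit_itv)" by measurable
      finally show "{z\<in>space (RN k \<Otimes>\<^sub>M unit_itv). (case z of (x, t) \<Rightarrow> H k x t) \<le> s}
          \<in> sets (RN k \<Otimes>\<^sub>M unit_itv)" .
    qed
  qed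
qed

section \<open>Disintegrations and bicausal couplings\<close>

lemma kernel_chain_single:
  assumes "\<And>k. k < n \<Longrightarrow> \<kappa> k \<in> RN k \<rightarrow>\<^sub>M prob_algebra borel"
  shows "kernel_chain (\<lambda>k. RN k) borel (\<lambda>k x a. x(k := a)) (\<lambda>k x. restrict x {..<k}) (\<lambda>k x. x k)
    \<kappa> (kernel_product \<kappa>) (\<lambda>_. undefined) n"
proof
  show "(\<lambda>x. restrict x {..<k}) \<in> RN m \<rightarrow>\<^sub>M RN k" if "k \<le> m" for k m
    using that by (intro measurable_restrict_subset) auto
  show "(\<lambda>x. x k) \<in> RN m \<rightarrow>\<^sub>M borel" if "k < m" for k m
    using that by (intro measurable_component_singleton) auto
  show "restrict x {..<k} = x" if "x \<in> space (RN k)" for k x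
    using that by (simp add: space_PiM PiE_iff extensional_restrict)
qed (use assms in \<open>auto simp: fun_eq_iff space_PiM\<close>)

lemma kernel_chain_pair:
  assumes "\<And>k. k < n \<Longrightarrow> \<rho> k \<in> RN k \<Otimes>\<^sub>M RN k \<rightarrow>\<^sub>M prob_algebra (borel \<Otimes>\<^sub>M borel)"
  shows "kernel_chain (\<lambda>k. RN k \<Otimes>\<^sub>M RN k) (borel \<Otimes>\<^sub>M borel)
    (\<lambda>k s v. ((fst s)(k := fst v), (snd s)(k := snd v)))
    (\<lambda>k s. (restrict (fst s) {..<k}, restrict (snd s) {..<k})) (\<lambda>k s. (fst s k, snd s k))
    \<rho> (pair_kernel_product \<rho>) (\<lambda>_. undefined, \<lambda>_. undefined) n"
proof
  show "(\<lambda>(s, v). ((fst s)(k := fst v), (snd s)(k := snd v)))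
      \<in> (RN k \<Otimes>\<^sub>M RN k) \<Otimes>\<^sub>M (borel \<Otimes>\<^sub>M borel) \<rightarrow>\<^sub>M RN (Suc k) \<Otimes>\<^sub>M RN (Suc k)" for k
    by measurable
  show "(\<lambda>s. (restrict (fst s) {..<k}, restrict (snd s) {..<k})) \<in> RN m \<Otimes>\<^sub>M RN m \<rightarrow>\<^sub>M RN k \<Otimes>\<^sub>M RN k"
    if "k \<le> m" for k m
  proof -
    have [measurable]: "(\<lambda>x. restrict x {..<k}) \<in> RN m \<rightarrow>\<^sub>M RN k"
      using that by (intro measurable_restrict_subset) auto
    show ?thesis by measurable
  qed
  show "(\<lambda>s. (fst s k, snd s k)) \<in> RN m \<Otimes>\<^sub>M RN m \<rightarrow>\<^sub>M borel \<Otimes>\<^sub>M borel" if "k < m" for k m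
  proof -
    have [measurable]: "(\<lambda>x. x k) \<in> RN m \<rightarrow>\<^sub>M borel"
      using that by (intro measurable_component_singleton) auto
    show ?thesis by measurable
  qed
  show "(restrict (fst s) {..<k}, restrict (snd s) {..<k}) = s" if "s \<in> space (RN k \<Otimes>\<^sub>M RN k)" for k s
    using that by (cases s) (simp add: space_pair_measure space_PiM PiE_iff extensional_restrict)
qed (use assms in \<open>auto simp: fun_eq_iff space_pair_measure space_PiM case_prod_unfold\<close>)

section \<open>Almost sure uniqueness of disintegrations\<close>

text \<open>Right-continuity extends equality of the distribution functions from the rationals to
  the line. With countably many tests, almost sure equality of kernels can be checked one test at a
  time.\<close>

lemma borel_prob_eqI_rat:
  fixes M M' :: "real measure"
  assumes "M \<in> space (prob_algebra borel)" "M' \<in> space (prob_algebra borel)"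
    and eq: "\<And>q :: rat. emeasure M {..of_rat q} = emeasure M' {..of_rat q}"
  shows "M = M'"
proof -
  have real: "real_distribution M" "real_distribution M'"
    using assms(1,2) by (auto simp: real_distribution_def real_distribution_axioms_def space_prob_algebra)
  interpret M: real_distribution M by fact
  interpret M': real_distribution M' by fact
  have "cdf M x = cdf M' x" for x
  proof (rule ccontr)
    assume neq: "cdf M x \<noteq> cdf M' x"
    have "((\<lambda>y. cdf M y - cdf M' y) \<longlongrightarrow> cdf M x - cdf M' x) (at_right x)"
      using M.cdf_is_right_cont[of x] M'.cdf_is_right_cont[of x]
      by (intro tendsto_diff) (auto simp: continuous_within)
    moreover have "cdf M x - cdf M' x \<noteq> 0" using neq by simp
    ultimately have "eventually (\<lambda>y. cdf M y - cdf M' y \<noteq> 0) (at_right x)"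
      by (rule tendsto_imp_eventually_ne)
    then obtain b where b: "b > x" "\<And>y. y > x \<Longrightarrow> y < b \<Longrightarrow> cdf M y - cdf M' y \<noteq> 0"
      by (auto simp: eventually_at_right_field)
    obtain q where "x < of_rat q" "of_rat q < b" using of_rat_dense[OF b(1)] by auto
    then show False using b(2)[of "of_rat q"] eq[of q] by (simp add: cdf_def measure_def)
  qed
  then show ?thesis by (intro cdf_unique real) auto
qed

text \<open>For fixed \<open>q\<close> the kernel mass of \<open>{..q}\<close> is a density, with
  respect to the law of the past, of the measure that gives \<open>A\<close> the probability that
  the past lies in \<open>A\<close> and coordinate \<open>k\<close> is at most \<open>q\<close>.
  This measure involves \<open>\<mu>\<close> alone, and densities are almost surely unique.\<close>

lemma disintegration_unique:
  assumes \<kappa>: "disintegration N \<mu> \<kappa>" and \<kappa>': "disintegration N \<mu> \<kappa>'" and k: "k < N"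
  shows "AE x in \<mu>. \<kappa> k (restrict x {..<k}) = \<kappa>' k (restrict x {..<k})"
proof -
  interpret K: kernel_chain "\<lambda>k. RN k" borel "\<lambda>k x a. x(k := a)" "\<lambda>k x. restrict x {..<k}" "\<lambda>k x. x k"
    \<kappa> "kernel_product \<kappa>" "\<lambda>_. undefined" N
    using \<kappa> by (intro kernel_chain_single) (auto simp: disintegration_def)
  interpret K': kernel_chain "\<lambda>k. RN k" borel "\<lambda>k x a. x(k := a)" "\<lambda>k x. restrict x {..<k}" "\<lambda>k x. x k"
    \<kappa>' "kernel_product \<kappa>'" "\<lambda>_. undefined" N
    using \<kappa>' by (intro kernel_chain_single) (auto simp: disintegration_def)
  have \<mu>: "\<mu> = kernel_product \<kappa> N" "\<mu> = kernel_product \<kappa>' N" using \<kappa> \<kappa>' by (auto simp: disintegration_def)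
  interpret \<mu>: prob_space \<mu> using K.prob_space_P[of N] \<mu> by simp
  have [measurable_cong]: "sets \<mu> = sets (RN N)" using K.sets_P[of N] \<mu> by simp
  let ?r = "\<lambda>x. restrict x {..<k} :: nat \<Rightarrow> real"
  have r[measurable]: "?r \<in> \<mu> \<rightarrow>\<^sub>M RN k" using K.r_measurable[of k N] k by simp
  define M where "M = distr \<mu> (RN k) ?r"
  interpret M: prob_space M unfolding M_def by (rule \<mu>.prob_space_distr) measurable
  have [measurable]: "\<kappa> k \<in> RN k \<rightarrow>\<^sub>M prob_algebra borel" "\<kappa>' k \<in> RN k \<rightarrow>\<^sub>M prob_algebra borel"
    using K.K_measurable K'.K_measurable k by auto
  have step: "emeasure (density M (\<lambda>x. emeasure (\<iota> k x) {..q})) A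
      = (\<integral>\<^sup>+x. indicator A (?r x) * indicator {..q} (x k) \<partial>\<mu>)"
    if "disintegration N \<mu> \<iota>" and A[measurable]: "A \<in> sets (RN k)" for \<iota> q A
  proof -
    interpret I: kernel_chain "\<lambda>k. RN k" borel "\<lambda>k x a. x(k := a)" "\<lambda>k x. restrict x {..<k}" "\<lambda>k x. x k"
      \<iota> "kernel_product \<iota>" "\<lambda>_. undefined" N
      using that by (intro kernel_chain_single) (auto simp: disintegration_def)
    have [measurable]: "\<iota> k \<in> RN k \<rightarrow>\<^sub>M prob_algebra borel" using I.K_measurable k by auto
    have [measurable]: "(\<lambda>x. emeasure (\<iota> k x) {..q}) \<in> borel_measurable (RN k)"
      by (rule measurable_emeasure_kernel[OF measurable_prob_algebraD[of _ _ borel]]) measurable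
    have "emeasure (density M (\<lambda>x. emeasure (\<iota> k x) {..q})) A
        = (\<integral>\<^sup>+x. emeasure (\<iota> k (?r x)) {..q} * indicator A (?r x) \<partial>\<mu>)"
      unfolding M_def by (subst emeasure_density) (simp_all add: nn_integral_distr)
    also have "\<dots> = (\<integral>\<^sup>+x. (\<integral>\<^sup>+v. indicator A (?r x) * indicator {..q} v \<partial>\<iota> k (?r x)) \<partial>\<mu>)"
    proof (rule nn_integral_cong)
      fix x assume "x \<in> space \<mu>"
      then have "?r x \<in> space (RN k)" using r by (rule measurable_space[rotated])
      then have "sets (\<iota> k (?r x)) = sets borel" by (rule I.sets_K[OF k])
      then show "emeasure (\<iota> k (?r x)) {..q} * indicator A (?r x)
          = (\<integral>\<^sup>+v. indicator A (?r x) * indicator {..q} v \<partial>\<iota> k (?r x))"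
        by (subst nn_integral_cmult_indicator) (auto simp: mult.commute)
    qed
    also have "\<dots> = (\<integral>\<^sup>+x. indicator A (?r x) * indicator {..q} (x k) \<partial>\<mu>)"
      using I.nn_integral_step[OF k, of "\<lambda>x v. indicator A x * indicator {..q} v"] that(1)
      by (simp add: disintegration_def)
    finally show ?thesis .
  qed
  have "AE x in M. \<forall>q::rat. emeasure (\<kappa> k x) {..of_rat q} = emeasure (\<kappa>' k x) {..of_rat q}"
    unfolding AE_all_countable
  proof
    fix q :: rat
    have [measurable]: "(\<lambda>x. emeasure (\<kappa> k x) {..of_rat q}) \<in> borel_measurable (RN k)"
      by (rule measurable_emeasure_kernel[OF measurable_prob_algebraD[of _ _ borel]]) measurable
    have [measurable]: "(\<lambda>x. emeasure (\<kappa>' k x) {..of_rat q}) \<in> borel_measurable (RN k)"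
      by (rule measurable_emeasure_kernel[OF measurable_prob_algebraD[of _ _ borel]]) measurable
    have "density M (\<lambda>x. emeasure (\<kappa> k x) {..of_rat q}) = density M (\<lambda>x. emeasure (\<kappa>' k x) {..of_rat q})"
      using step[OF \<kappa>] step[OF \<kappa>'] by (intro measure_eqI) (auto simp: M_def)
    then show "AE x in M. emeasure (\<kappa> k x) {..of_rat q} = emeasure (\<kappa>' k x) {..of_rat q}"
      by (intro M.density_unique) (auto simp: M_def)
  qed
  moreover have "AE x in M. x \<in> space (RN k)" using AE_space[of M] by (simp add: M_def)
  ultimately have "AE x in M. \<kappa> k x = \<kappa>' k x"
    by eventually_elim (auto intro!: borel_prob_eqI_rat K.K_in K'.K_in k)
  then show ?thesis unfolding M_def by (rule AE_distrD[OF r])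
qed

section \<open>Laws of composed transports\<close>

lemma transport_kernel_measurable:
  assumes "monotone_transport N H" "k < N"
  shows "(\<lambda>x. distr unit_itv borel (H k x)) \<in> RN k \<rightarrow>\<^sub>M prob_algebra borel"
proof -
  have [measurable]: "(\<lambda>(x, t). H k x t) \<in> borel_measurable (RN k \<Otimes>\<^sub>M unit_itv)"
    using assms by (simp add: monotone_transport_def)
  have "(\<lambda>x. unit_itv) \<in> RN k \<rightarrow>\<^sub>M prob_algebra unit_itv"
    by (intro measurable_const) (simp add: space_prob_algebra prob_space_unit_itv)
  then show ?thesis by (rule measurable_distr_prob_space2) measurable
qed

lemma disintegration_composed:
  assumes H: "monotone_transport N H"
  shows "disintegration N (distr (unit_cube N) (RN N) (composed H N)) (\<lambda>k x. distr unit_itv borel (H k x))"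
proof -
  let ?\<kappa> = "\<lambda>k x. distr unit_itv borel (H k x)"
  interpret kernel_chain "\<lambda>k. RN k" borel "\<lambda>k x a. x(k := a)" "\<lambda>k x. restrict x {..<k}" "\<lambda>k x. x k"
    ?\<kappa> "kernel_product ?\<kappa>" "\<lambda>_. undefined" N
    using transport_kernel_measurable[OF H] by (rule kernel_chain_single)
  have "kernel_product ?\<kappa> N = distr (unit_cube N) (RN N) (composed H N)"
  proof (rule law[OF order.refl])
    show "composed H k \<in> unit_cube k \<rightarrow>\<^sub>M RN k" if "k \<le> N" for k
      using H that by (rule measurable_composed) simp
    show "H k x \<in> borel_measurable unit_itv" if "k < N" "x \<in> space (RN k)" for k x
      using H that by (auto simp: monotone_transport_def intro: measurable_mono_unit_itv)
    show "composed H (Suc k) (u(k := t)) = (composed H k u)(k := H k (composed H k u) t)" for k u t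
      using composed_cong[of k "u(k := t)" u H] by simp
  qed auto
  then show ?thesis using transport_kernel_measurable[OF H] by (simp add: disintegration_def)
qed

definition comonotone_kernel ::
  "(nat \<Rightarrow> (nat \<Rightarrow> real) \<Rightarrow> real \<Rightarrow> real) \<Rightarrow> (nat \<Rightarrow> (nat \<Rightarrow> real) \<Rightarrow> real \<Rightarrow> real) \<Rightarrow>
    nat \<Rightarrow> (nat \<Rightarrow> real) \<times> (nat \<Rightarrow> real) \<Rightarrow> (real \<times> real) measure" where
  "comonotone_kernel H H' k z = distr unit_itv (borel \<Otimes>\<^sub>M borel) (\<lambda>t. (H k (fst z) t, H' k (snd z) t))"

text \<open>When the same \<open>u\<close> is fed to both maps, step \<open>k\<close> draws one
  uniform \<open>t\<close> for both coordinates, so \<open>law\<close> applies to the chain of pairs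
  with the comonotone kernels.\<close>

lemma pair_disintegration_composed:
  assumes H: "monotone_transport N H" and H': "monotone_transport N H'"
  shows "pair_disintegration N
    (distr (unit_cube N) (RN N \<Otimes>\<^sub>M RN N) (\<lambda>u. (composed H N u, composed H' N u))) (comonotone_kernel H H')"
proof -
  have K: "comonotone_kernel H H' k \<in> RN k \<Otimes>\<^sub>M RN k \<rightarrow>\<^sub>M prob_algebra (borel \<Otimes>\<^sub>M borel)" if "k < N" for k
  proof -
    have [measurable]: "(\<lambda>(x, t). H k x t) \<in> borel_measurable (RN k \<Otimes>\<^sub>M unit_itv)"
      "(\<lambda>(x, t). H' k x t) \<in> borel_measurable (RN k \<Otimes>\<^sub>M unit_itv)"
      using H H' that by (auto simp: monotone_transport_def)
    have "(\<lambda>x. unit_itv) \<in> RN k \<Otimes>\<^sub>M RN k \<rightarrow>\<^sub>M prob_algebra unit_itv"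
      by (intro measurable_const) (simp add: space_prob_algebra prob_space_unit_itv)
    then show ?thesis unfolding comonotone_kernel_def[abs_def]
      by (rule measurable_distr_prob_space2) measurable
  qed
  interpret kernel_chain "\<lambda>k. RN k \<Otimes>\<^sub>M RN k" "borel \<Otimes>\<^sub>M borel"
    "\<lambda>k s v. ((fst s)(k := fst v), (snd s)(k := snd v))"
    "\<lambda>k s. (restrict (fst s) {..<k}, restrict (snd s) {..<k})" "\<lambda>k s. (fst s k, snd s k)"
    "comonotone_kernel H H'" "pair_kernel_product (comonotone_kernel H H')" "(\<lambda>_. undefined, \<lambda>_. undefined)" N
    using K by (rule kernel_chain_pair)
  have "pair_kernel_product (comonotone_kernel H H') N
      = distr (unit_cube N) (RN N \<Otimes>\<^sub>M RN N) (\<lambda>u. (composed H N u, composed H' N u))"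
  proof (rule law[where Z="\<lambda>k u. (composed H k u, composed H' k u)"
        and g="\<lambda>k z t. (H k (fst z) t, H' k (snd z) t)", OF order.refl])
    show "(\<lambda>u. (composed H k u, composed H' k u)) \<in> unit_cube k \<rightarrow>\<^sub>M RN k \<Otimes>\<^sub>M RN k" if "k \<le> N" for k
      using measurable_composed[OF H that] measurable_composed[OF H' that] by (intro measurable_Pair) auto
    show "(\<lambda>t. (H k (fst s) t, H' k (snd s) t)) \<in> unit_itv \<rightarrow>\<^sub>M borel \<Otimes>\<^sub>M borel"
      if "k < N" "s \<in> space (RN k \<Otimes>\<^sub>M RN k)" for k s
      using H H' that
      by (intro measurable_Pair) (auto simp: monotone_transport_def space_pair_measure intro!: measurable_mono_unit_itv)
    show "(composed H (Suc k) (u(k := t)), composed H' (Suc k) (u(k := t)))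
      = ((fst (composed H k u, composed H' k u))(k := fst (H k (fst (composed H k u, composed H' k u)) t,
            H' k (snd (composed H k u, composed H' k u)) t)),
         (snd (composed H k u, composed H' k u))(k := snd (H k (fst (composed H k u, composed H' k u)) t,
            H' k (snd (composed H k u, composed H' k u)) t)))" for k u t
      using composed_cong[of k "u(k := t)" u H] composed_cong[of k "u(k := t)" u H'] by simp
  qed (auto simp: comonotone_kernel_def)
  then show ?thesis using K by (simp add: pair_disintegration_def)
qed

lemma comonotone_kernel_coupling:
  assumes H: "monotone_transport N H" and H': "monotone_transport N H'" and k: "k < N"
    and x: "x \<in> space (RN k)" and y: "y \<in> space (RN k)"
  shows "comonotone_kernel H H' k (x, y) \<in> couplings (distr unit_itv borel (H k x)) (distr unit_itv borel (H' k y))"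
proof -
  have [measurable]: "H k x \<in> borel_measurable unit_itv" "H' k y \<in> borel_measurable unit_itv"
    using H H' k x y by (auto simp: monotone_transport_def intro!: measurable_mono_unit_itv)
  have m: "(\<lambda>t. (H k x t, H' k y t)) \<in> unit_itv \<rightarrow>\<^sub>M borel \<Otimes>\<^sub>M borel" by measurable
  have "prob_space (comonotone_kernel H H' k (x, y))"
    using unit_itv.prob_space_distr[OF m] by (simp add: comonotone_kernel_def)
  moreover have "distr (comonotone_kernel H H' k (x, y)) borel fst = distr unit_itv borel (H k x)"
    "distr (comonotone_kernel H H' k (x, y)) borel snd = distr unit_itv borel (H' k y)"
    using distr_distr[OF measurable_fst m] distr_distr[OF measurable_snd m]
    by (simp_all add: comonotone_kernel_def comp_def)
  ultimately show ?thesis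
    by (simp add: couplings_def space_prob_algebra comonotone_kernel_def cong: distr_cong sets_pair_measure_cong)
qed

text \<open>Running the chain with quantile functions of the kernels realises \<open>\<mu>\<close>.
  Hence the choice in \<open>the_quantile_process\<close> is made from a nonempty set.\<close>

lemma quantile_process_exists:
  assumes "disintegration N \<mu> \<kappa>"
  obtains Q where "quantile_process N Q" "distr (unit_cube N) (RN N) Q = \<mu>"
proof -
  have \<kappa>: "\<kappa> k \<in> RN k \<rightarrow>\<^sub>M prob_algebra borel" if "k < N" for k
    using assms that by (simp add: disintegration_def)
  obtain H where H: "monotone_transport N H"
    and eq: "\<And>k x. k < N \<Longrightarrow> x \<in> space (RN k) \<Longrightarrow> distr unit_itv borel (H k x) = \<kappa> k x"
    using monotone_transport_of_kernels[OF \<kappa>] by blast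
  let ?\<kappa> = "\<lambda>k x. distr unit_itv borel (H k x)"
  interpret kernel_chain "\<lambda>k. RN k" borel "\<lambda>k x a. x(k := a)" "\<lambda>k x. restrict x {..<k}" "\<lambda>k x. x k"
    \<kappa> "kernel_product \<kappa>" "\<lambda>_. undefined" N
    using \<kappa> by (rule kernel_chain_single)
  have "kernel_product \<kappa> k = kernel_product ?\<kappa> k" if "k \<le> N" for k
    using that
  proof (induction k)
    case (Suc k)
    then have "kernel_product \<kappa> k = kernel_product ?\<kappa> k" "k < N" by auto
    then show ?case using eq space_P[of k] by (auto intro!: bind_cong)
  qed simp
  then have "distr (unit_cube N) (RN N) (composed H N) = \<mu>"
    using disintegration_composed[OF H] assms by (simp add: disintegration_def)
  then show thesis using that quantile_process_composed[OF H] by blast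
qed

lemma the_quantile_process:
  assumes "disintegration N \<mu> \<kappa>"
  shows "quantile_process N (the_quantile_process N \<mu>)"
    "distr (unit_cube N) (RN N) (the_quantile_process N \<mu>) = \<mu>"
proof -
  obtain Q where "quantile_process N Q \<and> distr (unit_cube N) (RN N) Q = \<mu>"
    using quantile_process_exists[OF assms] by blast
  then have "quantile_process N (the_quantile_process N \<mu>) \<and> distr (unit_cube N) (RN N) (the_quantile_process N \<mu>) = \<mu>"
    unfolding the_quantile_process_def by (intro someI_ex[of "\<lambda>Q. quantile_process N Q \<and> distr (unit_cube N) (RN N) Q = \<mu>"]) blast
  then show "quantile_process N (the_quantile_process N \<mu>)"
    "distr (unit_cube N) (RN N) (the_quantile_process N \<mu>) = \<mu>" by auto
qed

lemma the_quantile_process_composed: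
  assumes "disintegration N \<mu> \<kappa>"
  obtains H where "monotone_transport N H"
    "\<And>u. u \<in> space (unit_cube N) \<Longrightarrow> the_quantile_process N \<mu> u = composed H N u"
    "distr (unit_cube N) (RN N) (composed H N) = \<mu>"
proof -
  obtain H where H: "monotone_transport N H"
    "\<And>u. u \<in> space (unit_cube N) \<Longrightarrow> the_quantile_process N \<mu> u = composed H N u"
    using quantile_process_eq_composed[OF the_quantile_process(1)[OF assms]] by blast
  have "distr (unit_cube N) (RN N) (composed H N) = distr (unit_cube N) (RN N) (the_quantile_process N \<mu>)"
    using H(2) by (intro distr_cong) auto
  then show thesis using that H the_quantile_process(2)[OF assms] by simp
qed

section \<open>Marginals of couplings and the coupling behind \<open>KR\<close>\<close>

lemma measurable_lp_pow_diff [measurable]: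
  "(\<lambda>z. lp_pow p n (\<lambda>i. fst z i - snd z i)) \<in> borel_measurable (RN n \<Otimes>\<^sub>M RN n)"
proof -
  have [measurable]: "(\<lambda>x. x i) \<in> borel_measurable (RN n)" if "i < n" for i
    using that by (intro measurable_component_singleton) auto
  show ?thesis unfolding lp_pow_def by (intro borel_measurable_sum) measurable
qed

lemma
  assumes "\<pi> \<in> couplings \<mu> \<nu>"
  shows sets_coupling: "sets \<pi> = sets (\<mu> \<Otimes>\<^sub>M \<nu>)"
    and prob_space_coupling: "prob_space \<pi>"
    and distr_fst_coupling: "distr \<pi> \<mu> fst = \<mu>"
    and distr_snd_coupling: "distr \<pi> \<nu> snd = \<nu>"
  using assms by (auto simp: couplings_def space_prob_algebra)

lemma
  assumes \<pi>: "\<pi> \<in> couplings \<mu> \<nu>"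
  shows measurable_fst_coupling: "fst \<in> \<pi> \<rightarrow>\<^sub>M \<mu>"
    and measurable_snd_coupling: "snd \<in> \<pi> \<rightarrow>\<^sub>M \<nu>"
  using measurable_cong_sets[OF sets_coupling[OF \<pi>] refl] by (auto intro: measurable_fst measurable_snd)

lemma
  assumes \<pi>: "\<pi> \<in> couplings \<mu> \<nu>"
  shows AE_fst_coupling: "AE x in \<mu>. P x \<Longrightarrow> AE z in \<pi>. P (fst z)"
    and AE_snd_coupling: "AE y in \<nu>. R y \<Longrightarrow> AE z in \<pi>. R (snd z)"
  using AE_distrD[OF measurable_fst_coupling[OF \<pi>], of P, unfolded distr_fst_coupling[OF \<pi>]]
    AE_distrD[OF measurable_snd_coupling[OF \<pi>], of R, unfolded distr_snd_coupling[OF \<pi>]]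
  by blast+

text \<open>The kernels pushed forward by \<open>H\<close> and \<open>H'\<close> disintegrate the
  marginals, and the comonotone kernels couple them at every past. So the joint law competes in the
  infimum \<open>AW\<close>, and with \<open>KR_eq_cost\<close> this gives the first
  inequality.\<close>

lemma bicausal_composed:
  assumes H: "monotone_transport N H" "distr (unit_cube N) (RN N) (composed H N) = \<mu>"
    and H': "monotone_transport N H'" "distr (unit_cube N) (RN N) (composed H' N) = \<nu>"
  shows "distr (unit_cube N) (RN N \<Otimes>\<^sub>M RN N) (\<lambda>u. (composed H N u, composed H' N u)) \<in> bicausal_couplings N \<mu> \<nu>"
proof -
  define \<gamma> where "\<gamma> = distr (unit_cube N) (RN N \<Otimes>\<^sub>M RN N) (\<lambda>u. (composed H N u, composed H' N u))"
  interpret cube: prob_space "unit_cube N" by (rule prob_space_unit_cube)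
  have [measurable]: "composed H N \<in> unit_cube N \<rightarrow>\<^sub>M RN N" "composed H' N \<in> unit_cube N \<rightarrow>\<^sub>M RN N"
    using H H' by (auto intro: measurable_composed)
  have sets: "sets \<mu> = sets (RN N)" "sets \<nu> = sets (RN N)" using H(2) H'(2) by auto
  have "\<gamma> \<in> couplings \<mu> \<nu>"
  proof -
    have "prob_space \<gamma>" unfolding \<gamma>_def by (rule cube.prob_space_distr) measurable
    moreover have "distr \<gamma> (RN N) fst = \<mu>" "distr \<gamma> (RN N) snd = \<nu>"
      unfolding \<gamma>_def using H(2) H'(2) by (subst distr_distr; simp add: comp_def)+
    moreover have "distr \<gamma> \<mu> fst = distr \<gamma> (RN N) fst" "distr \<gamma> \<nu> snd = distr \<gamma> (RN N) snd"
      using sets by (auto intro: distr_cong)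
    ultimately show ?thesis
      using sets_pair_measure_cong[OF sets] by (simp add: couplings_def space_prob_algebra \<gamma>_def)
  qed
  moreover have "disintegration N \<mu> (\<lambda>k x. distr unit_itv borel (H k x))"
    "disintegration N \<nu> (\<lambda>k x. distr unit_itv borel (H' k x))"
    using disintegration_composed[OF H(1)] disintegration_composed[OF H'(1)] H(2) H'(2) by auto
  moreover have "pair_disintegration N \<gamma> (comonotone_kernel H H')"
    unfolding \<gamma>_def by (rule pair_disintegration_composed[OF H(1) H'(1)])
  moreover have "AE (x, y) in \<gamma>. \<forall>k<N. comonotone_kernel H H' k (restrict x {..<k}, restrict y {..<k})
      \<in> couplings (distr unit_itv borel (H k (restrict x {..<k}))) (distr unit_itv borel (H' k (restrict y {..<k})))"
    by (auto intro!: AE_I2 comonotone_kernel_coupling[OF H(1) H'(1)] simp: space_PiM)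
  ultimately have "\<gamma> \<in> bicausal_couplings N \<mu> \<nu>"
    unfolding bicausal_couplings_def by blast
  then show ?thesis by (simp only: \<gamma>_def)
qed

lemma KR_eq_cost:
  assumes H: "monotone_transport N H" "\<And>u. u \<in> space (unit_cube N) \<Longrightarrow> the_quantile_process N \<mu> u = composed H N u"
    and H': "monotone_transport N H'" "\<And>u. u \<in> space (unit_cube N) \<Longrightarrow> the_quantile_process N \<nu> u = composed H' N u"
  shows "KR p N \<mu> \<nu> = ennroot p (\<integral>\<^sup>+(x, y). ennreal (lp_pow p N (\<lambda>i. x i - y i))
    \<partial>distr (unit_cube N) (RN N \<Otimes>\<^sub>M RN N) (\<lambda>u. (composed H N u, composed H' N u)))"
proof -
  have [measurable]: "composed H N \<in> unit_cube N \<rightarrow>\<^sub>M RN N" "composed H' N \<in> unit_cube N \<rightarrow>\<^sub>M RN N"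
    using H H' by (auto intro: measurable_composed)
  have "(\<integral>\<^sup>+(x, y). ennreal (lp_pow p N (\<lambda>i. x i - y i))
        \<partial>distr (unit_cube N) (RN N \<Otimes>\<^sub>M RN N) (\<lambda>u. (composed H N u, composed H' N u)))
      = (\<integral>\<^sup>+u. ennreal (lp_pow p N (\<lambda>i. composed H N u i - composed H' N u i)) \<partial>unit_cube N)"
    unfolding case_prod_unfold by (subst nn_integral_distr) auto
  also have "\<dots> = (\<integral>\<^sup>+u. ennreal (lp_pow p N
      (\<lambda>i. the_quantile_process N \<mu> u i - the_quantile_process N \<nu> u i)) \<partial>unit_cube N)"
    using H(2) H'(2) by (intro nn_integral_cong) simp
  finally show ?thesis unfolding KR_def by simp
qed

section \<open>Comparison of the costs\<close>

lemma ennroot_mono: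
  assumes "p > 0" "s \<le> t"
  shows "ennroot p s \<le> ennroot p t"
proof (cases "t = \<top>")
  case False
  then have "s \<noteq> \<top>" using assms(2) by (auto simp: top_unique)
  then show ?thesis using assms False
    by (auto simp: ennroot_def intro!: ennreal_leI powr_mono2 enn2real_mono simp: less_top)
qed (simp add: ennroot_def)

lemma ennroot_mult:
  assumes "c \<ge> 0" "p > 0"
  shows "ennroot p (ennreal c * t) \<le> ennreal (c powr (1 / p)) * ennroot p t"
proof (cases "c = 0 \<or> t = \<top>")
  case True
  then show ?thesis using assms by (auto simp: ennroot_def ennreal_mult_top)
next
  case False
  then show ?thesis using assms
    by (auto simp: ennroot_def ennreal_mult_eq_top_iff enn2real_mult powr_mult ennreal_mult'[symmetric])
qed

lemma le_of_ennroot_le: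
  assumes "p > 0" "c \<ge> 0" "ennroot p t \<le> ennreal c"
  shows "t \<le> ennreal (c powr p)"
proof (cases t)
  case (real r)
  then have "r powr (1 / p) \<le> c" using assms by (auto simp: ennroot_def)
  then have "(r powr (1 / p)) powr p \<le> c powr p" using assms by (intro powr_mono2) auto
  then show ?thesis using assms real by (simp add: powr_powr ennreal_leI)
qed (use assms in \<open>simp add: ennroot_def top_unique\<close>)

text \<open>The sum is at most three times the largest of the absolute values, and the power of the
  largest is one of the summands on the right.\<close>

lemma powr_sum3_le:
  fixes a b c p :: real
  assumes "p \<ge> 0"
  shows "\<bar>a + b + c\<bar> powr p \<le> 3 powr p * (\<bar>a\<bar> powr p + \<bar>b\<bar> powr p + \<bar>c\<bar> powr p)"
proof -
  define m where "m = max \<bar>a\<bar> (max \<bar>b\<bar> \<bar>c\<bar>)"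
  have "\<bar>a + b + c\<bar> \<le> 3 * m" by (auto simp: m_def)
  then have "\<bar>a + b + c\<bar> powr p \<le> (3 * m) powr p" using assms by (intro powr_mono2) auto
  also have "\<dots> = 3 powr p * m powr p" by (rule powr_mult)
  also have "m powr p \<le> \<bar>a\<bar> powr p + \<bar>b\<bar> powr p + \<bar>c\<bar> powr p"
  proof -
    have "m = \<bar>a\<bar> \<or> m = \<bar>b\<bar> \<or> m = \<bar>c\<bar>" by (simp add: m_def max_def)
    then show ?thesis by (elim disjE) simp_all
  qed
  finally show ?thesis by simp
qed

lemma lp_pow_nonneg [simp]: "0 \<le> lp_pow p k x"
  by (simp add: lp_pow_def sum_nonneg)

lemma lp_pow_Suc: "lp_pow p (Suc k) x = lp_pow p k x + \<bar>x k\<bar> powr p"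
  by (simp add: lp_pow_def)

lemma lp_pow_sum3_le:
  assumes "p \<ge> 0" "\<And>i. i < k \<Longrightarrow> x i = a i + b i + c i"
  shows "lp_pow p k x \<le> 3 powr p * (lp_pow p k a + lp_pow p k b + lp_pow p k c)"
  unfolding lp_pow_def sum.distrib[symmetric] sum_distrib_left
  using assms powr_sum3_le[OF assms(1)] by (intro sum_mono) auto

lemma lp_pow_minus_commute: "lp_pow p k (\<lambda>i. x i - y i) = lp_pow p k (\<lambda>i. y i - x i)"
  by (simp add: lp_pow_def abs_minus_commute)

lemma lp_pow_restrict: "lp_pow p k (\<lambda>i. restrict x {..<k} i - restrict y {..<k} i) = lp_pow p k (\<lambda>i. x i - y i)"
  by (simp add: lp_pow_def)

section \<open>Comonotone costs under the Lipschitz property\<close>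

text \<open>The comonotone coupling costs no more than any other, so its cost lies below the
  infimum. This turns the Lipschitz bound for kernels into a bound for monotone maps driven by the
  same \<open>t\<close>.\<close>

lemma wasserstein_comonotone:
  fixes h h' :: "real \<Rightarrow> real"
  assumes "p \<ge> 1" "c \<ge> 0" and h: "mono_on {0<..<1} h" "mono_on {0<..<1} h'"
    and W: "wasserstein p (distr unit_itv borel h) (distr unit_itv borel h') \<le> ennreal c"
  shows "(\<integral>\<^sup>+t. ennreal (\<bar>h t - h' t\<bar> powr p) \<partial>unit_itv) \<le> ennreal (c powr p)"
proof (rule le_of_ennroot_le)
  have "ennroot p (\<integral>\<^sup>+t. ennreal (\<bar>h t - h' t\<bar> powr p) \<partial>unit_itv)
      \<le> wasserstein p (distr unit_itv borel h) (distr unit_itv borel h')"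
    unfolding wasserstein_def using assms
    by (intro INF_greatest ennroot_mono comonotone_cost_le) auto
  also note W
  finally show "ennroot p (\<integral>\<^sup>+t. ennreal (\<bar>h t - h' t\<bar> powr p) \<partial>unit_itv) \<le> ennreal c" .
qed (use assms in auto)

lemma monotone_representation:
  assumes "M \<in> space (prob_algebra borel)"
  obtains h :: "real \<Rightarrow> real" where "mono_on {0<..<1} h" "distr unit_itv borel h = M"
proof -
  interpret cdf_distribution M
    using assms
    by (auto simp: cdf_distribution_def real_distribution_def real_distribution_axioms_def space_prob_algebra)
  show thesis using that mono_I distr_I_eq_M by blast
qed

definition lipschitz_kernel :: "real \<Rightarrow> real \<Rightarrow> nat \<Rightarrow> ((nat \<Rightarrow> real) \<Rightarrow> real measure) \<Rightarrow> bool" where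
  "lipschitz_kernel p L k \<kappa> \<longleftrightarrow> (\<forall>x\<in>space (RN k). \<forall>y\<in>space (RN k).
     wasserstein p (\<kappa> x) (\<kappa> y) \<le> ennreal (L * lp_norm p k (\<lambda>i. x i - y i)))"

lemma lipschitz_kernel_comonotone:
  fixes h h' :: "real \<Rightarrow> real"
  assumes "p \<ge> 1" "L > 0" and \<kappa>: "lipschitz_kernel p L k \<kappa>" and x: "x \<in> space (RN k)" "y \<in> space (RN k)"
    and h: "mono_on {0<..<1} h" "distr unit_itv borel h = \<kappa> x"
    and h': "mono_on {0<..<1} h'" "distr unit_itv borel h' = \<kappa> y"
  shows "(\<integral>\<^sup>+t. ennreal (\<bar>h t - h' t\<bar> powr p) \<partial>unit_itv)
    \<le> ennreal (L powr p * lp_pow p k (\<lambda>i. x i - y i))"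
proof -
  have "(\<integral>\<^sup>+t. ennreal (\<bar>h t - h' t\<bar> powr p) \<partial>unit_itv)
      \<le> ennreal ((L * lp_norm p k (\<lambda>i. x i - y i)) powr p)"
    using assms by (intro wasserstein_comonotone) (auto simp: lipschitz_kernel_def lp_norm_def)
  also have "(L * lp_norm p k (\<lambda>i. x i - y i)) powr p = L powr p * lp_pow p k (\<lambda>i. x i - y i)"
    using assms(1,2) by (simp add: powr_mult lp_norm_def powr_powr)
  finally show ?thesis .
qed

text \<open>Between \<open>h\<close> and \<open>h'\<close> monotone maps \<open>f\<close> for
  \<open>\<kappa> x\<close> and \<open>g\<close> for \<open>\<eta> y\<close> are inserted. All four
  are functions of one \<open>t\<close>, so the three-term inequality applies pointwise; the
  Lipschitz property bounds the outer differences and optimality against \<open>R\<close> the middle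
  one.\<close>

lemma comonotone_cost_lipschitz:
  fixes h h' :: "real \<Rightarrow> real"
  assumes p: "p \<ge> 1" and "L > 0" and \<kappa>: "lipschitz_kernel p L k \<kappa>" and \<eta>: "lipschitz_kernel p L k \<eta>"
    and in_prob: "\<kappa> x \<in> space (prob_algebra borel)" "\<eta> y \<in> space (prob_algebra borel)"
    and space: "x \<in> space (RN k)" "y \<in> space (RN k)" "x' \<in> space (RN k)" "y' \<in> space (RN k)"
    and h: "mono_on {0<..<1} h" "distr unit_itv borel h = \<kappa> x'"
    and h': "mono_on {0<..<1} h'" "distr unit_itv borel h' = \<eta> y'"
    and R: "R \<in> couplings (\<kappa> x) (\<eta> y)"
  shows "(\<integral>\<^sup>+t. ennreal (\<bar>h t - h' t\<bar> powr p) \<partial>unit_itv)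
    \<le> ennreal (3 powr p) * (ennreal (L powr p * lp_pow p k (\<lambda>i. x' i - x i))
       + (\<integral>\<^sup>+(a, b). ennreal (\<bar>a - b\<bar> powr p) \<partial>R) + ennreal (L powr p * lp_pow p k (\<lambda>i. y i - y' i)))"
proof -
  obtain f where f: "mono_on {0<..<1} f" "distr unit_itv borel f = \<kappa> x"
    using monotone_representation[OF in_prob(1)] .
  obtain g where g: "mono_on {0<..<1} g" "distr unit_itv borel g = \<eta> y"
    using monotone_representation[OF in_prob(2)] .
  note [measurable] = measurable_mono_unit_itv[OF h(1)] measurable_mono_unit_itv[OF h'(1)]
    measurable_mono_unit_itv[OF f(1)] measurable_mono_unit_itv[OF g(1)]
  have "(\<integral>\<^sup>+t. ennreal (\<bar>h t - h' t\<bar> powr p) \<partial>unit_itv)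
      \<le> (\<integral>\<^sup>+t. ennreal (3 powr p) * (ennreal (\<bar>h t - f t\<bar> powr p) + ennreal (\<bar>f t - g t\<bar> powr p)
          + ennreal (\<bar>g t - h' t\<bar> powr p)) \<partial>unit_itv)"
  proof (intro nn_integral_mono)
    fix t
    have "\<bar>h t - h' t\<bar> powr p \<le> 3 powr p * (\<bar>h t - f t\<bar> powr p + \<bar>f t - g t\<bar> powr p + \<bar>g t - h' t\<bar> powr p)"
      using powr_sum3_le[of p "h t - f t" "f t - g t" "g t - h' t"] p by simp
    then show "ennreal (\<bar>h t - h' t\<bar> powr p) \<le> ennreal (3 powr p) * (ennreal (\<bar>h t - f t\<bar> powr p)
        + ennreal (\<bar>f t - g t\<bar> powr p) + ennreal (\<bar>g t - h' t\<bar> powr p))"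
      by (simp add: ennreal_leI flip: ennreal_plus ennreal_mult')
  qed
  also have "\<dots> = ennreal (3 powr p) * ((\<integral>\<^sup>+t. ennreal (\<bar>h t - f t\<bar> powr p) \<partial>unit_itv)
      + (\<integral>\<^sup>+t. ennreal (\<bar>f t - g t\<bar> powr p) \<partial>unit_itv) + (\<integral>\<^sup>+t. ennreal (\<bar>g t - h' t\<bar> powr p) \<partial>unit_itv))"
    by (simp add: nn_integral_cmult nn_integral_add)
  also have "\<dots> \<le> ennreal (3 powr p) * (ennreal (L powr p * lp_pow p k (\<lambda>i. x' i - x i))
       + (\<integral>\<^sup>+(a, b). ennreal (\<bar>a - b\<bar> powr p) \<partial>R) + ennreal (L powr p * lp_pow p k (\<lambda>i. y i - y' i)))"
  proof (intro mult_left_mono add_mono)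
    show "(\<integral>\<^sup>+t. ennreal (\<bar>h t - f t\<bar> powr p) \<partial>unit_itv) \<le> ennreal (L powr p * lp_pow p k (\<lambda>i. x' i - x i))"
      by (rule lipschitz_kernel_comonotone[OF p \<open>L > 0\<close> \<kappa> space(3,1) h f])
    show "(\<integral>\<^sup>+t. ennreal (\<bar>g t - h' t\<bar> powr p) \<partial>unit_itv) \<le> ennreal (L powr p * lp_pow p k (\<lambda>i. y i - y' i))"
      by (rule lipschitz_kernel_comonotone[OF p \<open>L > 0\<close> \<eta> space(2,4) g h'])
    show "(\<integral>\<^sup>+t. ennreal (\<bar>f t - g t\<bar> powr p) \<partial>unit_itv) \<le> (\<integral>\<^sup>+(a, b). ennreal (\<bar>a - b\<bar> powr p) \<partial>R)"
      using R f g by (intro comonotone_cost_le p) auto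
  qed simp
  finally show ?thesis .
qed

section \<open>Cells of a grid\<close>

text \<open>Lists of integers form a countable type, as \<open>nn_integral_le_along_classes\<close>
  requires of the classes.\<close>

definition grid_cell :: "real \<Rightarrow> nat \<Rightarrow> (nat \<Rightarrow> real) \<Rightarrow> int list" where
  "grid_cell \<epsilon> k x = map (\<lambda>i. \<lfloor>x i / \<epsilon>\<rfloor>) [0..<k]"

lemma measurable_grid_cell:
  assumes "k \<le> n"
  shows "grid_cell \<epsilon> k \<in> RN n \<rightarrow>\<^sub>M count_space UNIV"
proof (subst measurable_count_space_eq2_countable, safe)
  fix l :: "int list"
  have eq: "grid_cell \<epsilon> k x = l \<longleftrightarrow> length l = k \<and> (\<forall>i\<in>{..<k}. \<lfloor>x i / \<epsilon>\<rfloor> = l ! i)" for x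
    unfolding grid_cell_def list_eq_iff_nth_eq by auto
  have "{x\<in>space (RN n). \<lfloor>x i / \<epsilon>\<rfloor> = l ! i} \<in> sets (RN n)" if "i \<in> {..<k}" for i
  proof -
    have [measurable]: "(\<lambda>x. x i) \<in> borel_measurable (RN n)"
      using that assms by (intro measurable_component_singleton) auto
    show ?thesis by measurable
  qed
  then have "{x\<in>space (RN n). length l = k \<and> (\<forall>i\<in>{..<k}. \<lfloor>x i / \<epsilon>\<rfloor> = l ! i)} \<in> sets (RN n)"
    by (intro sets.sets_Collect_conj sets.sets_Collect_const sets.sets_Collect_finite_All) auto
  also have "{x\<in>space (RN n). length l = k \<and> (\<forall>i\<in>{..<k}. \<lfloor>x i / \<epsilon>\<rfloor> = l ! i)}
      = grid_cell \<epsilon> k -` {l} \<inter> space (RN n)"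
    unfolding eq[symmetric] by blast
  finally show "grid_cell \<epsilon> k -` {l} \<inter> space (RN n) \<in> sets (RN n)" .
qed auto

lemma lp_pow_grid_cell:
  assumes "\<epsilon> > 0" "p \<ge> 0" and eq: "grid_cell \<epsilon> k x = grid_cell \<epsilon> k y"
  shows "lp_pow p k (\<lambda>i. x i - y i) \<le> real k * \<epsilon> powr p"
proof -
  have "\<bar>x i - y i\<bar> powr p \<le> \<epsilon> powr p" if "i < k" for i
  proof -
    have "\<lfloor>x i / \<epsilon>\<rfloor> = \<lfloor>y i / \<epsilon>\<rfloor>"
      using arg_cong[OF eq, of "\<lambda>l. l ! i"] that by (simp add: grid_cell_def)
    then have "\<bar>x i / \<epsilon> - y i / \<epsilon>\<bar> < 1" by linarith
    then have "\<bar>x i - y i\<bar> < \<epsilon>" using \<open>\<epsilon> > 0\<close> by (simp add: field_simps abs_less_iff)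
    then show ?thesis using \<open>p \<ge> 0\<close> by (intro powr_mono2) auto
  qed
  then have "lp_pow p k (\<lambda>i. x i - y i) \<le> (\<Sum>i<k. \<epsilon> powr p)"
    unfolding lp_pow_def by (intro sum_mono) auto
  then show ?thesis by simp
qed

text \<open>\<open>3 powr p\<close> multiplies the conditional cost of the given coupling.
  \<open>9 powr p * L powr p\<close> comes from two uses of the three-term inequality and one of the
  Lipschitz property. The factor 2 absorbs the coefficient
  \<open>(3 powr p + 9 powr p) * L powr p\<close> of the mesh error.\<close>

definition growth_const :: "real \<Rightarrow> real \<Rightarrow> real" where
  "growth_const p L = 3 powr p + 2 * 9 powr p * L powr p"

lemma growth_const_pos: "growth_const p L > 0"
  by (simp add: growth_const_def add_pos_nonneg)

text \<open>The two couplings are compared by gluing them along their first marginal. Gluing is replaced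
  by pairing points whose first components lie in the same cell of a grid of mesh \<open>\<epsilon>\<close>, so that no
  conditional distributions are needed; then \<open>\<epsilon> \<rightarrow> 0\<close>.\<close>

lemma bicausal_cost_step:
  assumes p: "p \<ge> 1" and L: "L > 0" and k: "k < N"
    and \<mu>: "disintegration N \<mu> \<kappa>" and \<nu>: "disintegration N \<nu> \<eta>"
    and lip: "lipschitz_kernel p L k (\<kappa> k)" "lipschitz_kernel p L k (\<eta> k)"
    and H: "monotone_transport N H" "distr (unit_cube N) (RN N) (composed H N) = \<mu>"
    and H': "monotone_transport N H'" "distr (unit_cube N) (RN N) (composed H' N) = \<nu>"
    and \<gamma>: "\<gamma> = distr (unit_cube N) (RN N \<Otimes>\<^sub>M RN N) (\<lambda>u. (composed H N u, composed H' N u))"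
    and \<pi>: "\<pi> \<in> bicausal_couplings N \<mu> \<nu>"
  shows "(\<integral>\<^sup>+z. ennreal (\<bar>fst z k - snd z k\<bar> powr p) \<partial>\<gamma>)
    \<le> ennreal (growth_const p L) * ((\<integral>\<^sup>+z. ennreal (lp_pow p (Suc k) (\<lambda>i. fst z i - snd z i)) \<partial>\<pi>)
        + (\<integral>\<^sup>+z. ennreal (lp_pow p k (\<lambda>i. fst z i - snd z i)) \<partial>\<gamma>))"
proof -
  let ?C = "growth_const p L"
  let ?r = "\<lambda>x. restrict x {..<k} :: nat \<Rightarrow> real"
  let ?rr = "\<lambda>z. (?r (fst z), ?r (snd z))"
  let ?c = "\<lambda>v :: real \<times> real. ennreal (\<bar>fst v - snd v\<bar> powr p)"
  let ?S = "\<lambda>z :: (nat \<Rightarrow> real) \<times> (nat \<Rightarrow> real). lp_pow p k (\<lambda>i. fst z i - snd z i)"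
  obtain \<kappa>' \<eta>' \<rho> where \<pi>_coup: "\<pi> \<in> couplings \<mu> \<nu>"
    and \<kappa>': "disintegration N \<mu> \<kappa>'" and \<eta>': "disintegration N \<nu> \<eta>'" and \<rho>: "pair_disintegration N \<pi> \<rho>"
    and bc: "AE (x, y) in \<pi>. \<forall>k<N. \<rho> k (restrict x {..<k}, restrict y {..<k})
        \<in> couplings (\<kappa>' k (restrict x {..<k})) (\<eta>' k (restrict y {..<k}))"
    using \<pi> unfolding bicausal_couplings_def by blast
  have \<gamma>_coup: "\<gamma> \<in> couplings \<mu> \<nu>"
    using bicausal_composed[OF H H'] by (simp add: bicausal_couplings_def \<gamma>)
  define \<sigma> where "\<sigma> = comonotone_kernel H H'"
  have \<sigma>: "pair_disintegration N \<gamma> \<sigma>"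
    unfolding \<gamma> \<sigma>_def by (rule pair_disintegration_composed[OF H(1) H'(1)])
  interpret G: kernel_chain "\<lambda>k. RN k \<Otimes>\<^sub>M RN k" "borel \<Otimes>\<^sub>M borel"
    "\<lambda>k s v. ((fst s)(k := fst v), (snd s)(k := snd v))"
    "\<lambda>k s. (restrict (fst s) {..<k}, restrict (snd s) {..<k})" "\<lambda>k s. (fst s k, snd s k)"
    \<sigma> "pair_kernel_product \<sigma>" "(\<lambda>_. undefined, \<lambda>_. undefined)" N
    using \<sigma> by (intro kernel_chain_pair) (auto simp: pair_disintegration_def)
  interpret P: kernel_chain "\<lambda>k. RN k \<Otimes>\<^sub>M RN k" "borel \<Otimes>\<^sub>M borel"
    "\<lambda>k s v. ((fst s)(k := fst v), (snd s)(k := snd v))"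
    "\<lambda>k s. (restrict (fst s) {..<k}, restrict (snd s) {..<k})" "\<lambda>k s. (fst s k, snd s k)"
    \<rho> "pair_kernel_product \<rho>" "(\<lambda>_. undefined, \<lambda>_. undefined)" N
    using \<rho> by (intro kernel_chain_pair) (auto simp: pair_disintegration_def)
  have \<gamma>_eq: "\<gamma> = pair_kernel_product \<sigma> N" and \<pi>_eq: "\<pi> = pair_kernel_product \<rho> N"
    using \<sigma> \<rho> by (auto simp: pair_disintegration_def)
  interpret \<gamma>: prob_space \<gamma> using \<gamma>_coup by (rule prob_space_coupling)
  interpret \<pi>: prob_space \<pi> using \<pi>_coup by (rule prob_space_coupling)
  have [measurable_cong]: "sets \<gamma> = sets (RN N \<Otimes>\<^sub>M RN N)" "sets \<pi> = sets (RN N \<Otimes>\<^sub>M RN N)"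
    using G.sets_P[of N] P.sets_P[of N] by (auto simp: \<gamma>_eq \<pi>_eq)
  have sets_\<mu>: "sets \<mu> = sets (RN N)" using H(2) by auto
  have [measurable]: "?rr \<in> RN N \<Otimes>\<^sub>M RN N \<rightarrow>\<^sub>M RN k \<Otimes>\<^sub>M RN k"
    using G.r_measurable[of k N] k by simp
  have [measurable]: "(\<lambda>x. x i) \<in> borel_measurable (RN N)" if "i < N" for i
    using that by (intro measurable_component_singleton) auto
  have S_meas[measurable]: "?S \<in> borel_measurable (RN N \<Otimes>\<^sub>M RN N)"
    unfolding lp_pow_def using k by (intro borel_measurable_sum) measurable
  have "(\<lambda>s. \<integral>\<^sup>+v. ?c v \<partial>\<sigma> k s) \<in> borel_measurable (RN k \<Otimes>\<^sub>M RN k)"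
    "(\<lambda>s. \<integral>\<^sup>+v. ?c v \<partial>\<rho> k s) \<in> borel_measurable (RN k \<Otimes>\<^sub>M RN k)"
    using G.K_measurable[OF k] P.K_measurable[OF k]
    by (intro nn_integral_measurable_subprob_algebra2[where N="borel \<Otimes>\<^sub>M borel"] measurable_prob_algebraD; measurable)+
  then have [measurable]: "(\<lambda>z. \<integral>\<^sup>+v. ?c v \<partial>\<sigma> k (?rr z)) \<in> borel_measurable (RN N \<Otimes>\<^sub>M RN N)"
    "(\<lambda>z. \<integral>\<^sup>+v. ?c v \<partial>\<rho> k (?rr z)) \<in> borel_measurable (RN N \<Otimes>\<^sub>M RN N)"
    by (auto intro: measurable_compose[of ?rr, rotated])
  have \<gamma>_step: "(\<integral>\<^sup>+z. ennreal (\<bar>fst z k - snd z k\<bar> powr p) \<partial>\<gamma>) = (\<integral>\<^sup>+z. (\<integral>\<^sup>+v. ?c v \<partial>\<sigma> k (?rr z)) \<partial>\<gamma>)"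
    using G.nn_integral_step[OF k, of "\<lambda>_ v. ?c v"] by (simp add: \<gamma>_eq)
  have \<pi>_step: "(\<integral>\<^sup>+z. ennreal (\<bar>fst z k - snd z k\<bar> powr p) \<partial>\<pi>) = (\<integral>\<^sup>+z. (\<integral>\<^sup>+v. ?c v \<partial>\<rho> k (?rr z)) \<partial>\<pi>)"
    using P.nn_integral_step[OF k, of "\<lambda>_ v. ?c v"] by (simp add: \<pi>_eq)
  have r_space: "?r x \<in> space (RN k)" for x :: "nat \<Rightarrow> real" by (simp add: space_PiM)
  have \<kappa>_in: "\<kappa> k x \<in> space (prob_algebra borel)" "\<eta> k x \<in> space (prob_algebra borel)" if "x \<in> space (RN k)" for x
    using \<mu> \<nu> k that measurable_space[of "\<kappa> k" "RN k" "prob_algebra borel" x]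
      measurable_space[of "\<eta> k" "RN k" "prob_algebra borel" x] by (auto simp: disintegration_def)
  \<comment> \<open>Three versions of the kernels are in play: the Lipschitz ones, those witnessing
    bicausality, and those pushed forward by the transports. Uniqueness identifies them almost
    surely, and the marginal conditions carry the null sets over to the couplings.\<close>
  have AE_\<gamma>: "AE z in \<gamma>. distr unit_itv borel (H k (?r (fst z))) = \<kappa> k (?r (fst z)) \<and>
      distr unit_itv borel (H' k (?r (snd z))) = \<eta> k (?r (snd z))"
    using AE_fst_coupling[OF \<gamma>_coup disintegration_unique[OF disintegration_composed[OF H(1), unfolded H(2)] \<mu> k]]
      AE_snd_coupling[OF \<gamma>_coup disintegration_unique[OF disintegration_composed[OF H'(1), unfolded H'(2)] \<nu> k]]
    by eventually_elim simp
  have AE_\<pi>: "AE w in \<pi>. \<rho> k (?rr w) \<in> couplings (\<kappa> k (?r (fst w))) (\<eta> k (?r (snd w)))"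
    using AE_fst_coupling[OF \<pi>_coup disintegration_unique[OF \<kappa>' \<mu> k]]
      AE_snd_coupling[OF \<pi>_coup disintegration_unique[OF \<eta>' \<nu> k]] bc
    by eventually_elim (use k in \<open>auto simp: case_prod_unfold\<close>)
  have S_Suc: "(\<integral>\<^sup>+w. ennreal (lp_pow p (Suc k) (\<lambda>i. fst w i - snd w i)) \<partial>\<pi>)
      = (\<integral>\<^sup>+w. (\<integral>\<^sup>+v. ?c v \<partial>\<rho> k (?rr w)) \<partial>\<pi>) + (\<integral>\<^sup>+w. ennreal (?S w) \<partial>\<pi>)"
    using k by (simp add: lp_pow_Suc \<pi>_step[symmetric] nn_integral_add add.commute)
  have approx: "(\<integral>\<^sup>+z. ennreal (\<bar>fst z k - snd z k\<bar> powr p) \<partial>\<gamma>)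
      \<le> ennreal ?C * ((\<integral>\<^sup>+w. ennreal (lp_pow p (Suc k) (\<lambda>i. fst w i - snd w i)) \<partial>\<pi>)
        + (\<integral>\<^sup>+z. ennreal (?S z) \<partial>\<gamma>)) + ennreal (?C * (real k * \<epsilon> powr p))" if "\<epsilon> > 0" for \<epsilon>
  proof -
    define e where "e = real k * \<epsilon> powr p"
    have e: "e \<ge> 0" by (simp add: e_def)
    define cell where "cell = (\<lambda>z :: (nat \<Rightarrow> real) \<times> (nat \<Rightarrow> real). grid_cell \<epsilon> k (fst z))"
    have gc: "grid_cell \<epsilon> k \<in> \<mu> \<rightarrow>\<^sub>M count_space UNIV"
      using measurable_grid_cell[of k N \<epsilon>] k by (simp add: measurable_cong_sets[OF sets_\<mu> refl])
    have cell_meas: "cell \<in> \<gamma> \<rightarrow>\<^sub>M count_space UNIV" "cell \<in> \<pi> \<rightarrow>\<^sub>M count_space UNIV"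
      unfolding cell_def
      using measurable_compose[OF measurable_fst_coupling[OF \<gamma>_coup] gc]
        measurable_compose[OF measurable_fst_coupling[OF \<pi>_coup] gc] by auto
    have cell_distr: "distr \<gamma> (count_space UNIV) cell = distr \<pi> (count_space UNIV) cell"
      using distr_distr[OF gc measurable_fst_coupling[OF \<gamma>_coup]]
        distr_distr[OF gc measurable_fst_coupling[OF \<pi>_coup]]
      by (simp add: distr_fst_coupling[OF \<gamma>_coup] distr_fst_coupling[OF \<pi>_coup] cell_def comp_def)
    \<comment> \<open>The gluing wants a bound split into a function of \<open>w\<close> and a
      function of \<open>z\<close>; \<open>g\<close> collects the former together with the mesh
      error \<open>e\<close>.\<close>
    define g where "g w = ennreal ?C * ((\<integral>\<^sup>+v. ?c v \<partial>\<rho> k (?rr w)) + ennreal (?S w) + ennreal e)" for w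
    have [measurable]: "g \<in> borel_measurable (RN N \<Otimes>\<^sub>M RN N)" unfolding g_def by measurable
    have "(\<integral>\<^sup>+z. (\<integral>\<^sup>+v. ?c v \<partial>\<sigma> k (?rr z)) \<partial>\<gamma>)
        \<le> (\<integral>\<^sup>+w. g w \<partial>\<pi>) + (\<integral>\<^sup>+z. ennreal ?C * ennreal (?S z) \<partial>\<gamma>)"
    proof (rule nn_integral_le_along_classes[OF \<gamma>.prob_space_axioms \<pi>.prob_space_axioms cell_meas cell_distr])
      show "AE z in \<gamma>. AE w in \<pi>. cell z = cell w \<longrightarrow>
          (\<integral>\<^sup>+v. ?c v \<partial>\<sigma> k (?rr z)) \<le> g w + ennreal ?C * ennreal (?S z)"
        using AE_\<gamma>
      proof eventually_elim
        case (elim z)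
        note z = this
        show ?case
          using AE_\<pi>
        proof (eventually_elim, intro impI)
          fix w assume w: "\<rho> k (?rr w) \<in> couplings (\<kappa> k (?r (fst w))) (\<eta> k (?r (snd w)))"
            and "cell z = cell w"
          then have near: "lp_pow p k (\<lambda>i. fst z i - fst w i) \<le> e"
            unfolding e_def cell_def using p \<open>\<epsilon> > 0\<close> by (intro lp_pow_grid_cell) auto
          \<comment> \<open>The path from \<open>snd w\<close> to \<open>snd z\<close> runs through
            \<open>fst w\<close> and \<open>fst z\<close>; its middle leg is short because the first
            components share a cell.\<close>
          have far: "lp_pow p k (\<lambda>i. snd w i - snd z i) \<le> 3 powr p * (?S w + e + ?S z)"
          proof -
            have "lp_pow p k (\<lambda>i. snd w i - snd z i) \<le> 3 powr p * (lp_pow p k (\<lambda>i. snd w i - fst w i)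
                + lp_pow p k (\<lambda>i. fst w i - fst z i) + ?S z)"
              using p by (intro lp_pow_sum3_le) auto
            also have "\<dots> \<le> 3 powr p * (?S w + e + ?S z)"
              using near lp_pow_minus_commute[of p k "fst z" "fst w"] lp_pow_minus_commute[of p k "fst w" "snd w"]
              by (intro mult_left_mono add_mono) simp_all
            finally show ?thesis .
          qed
          define R where "R = (\<integral>\<^sup>+v. ?c v \<partial>\<rho> k (?rr w))"
          have mono: "mono_on {0<..<1} (H k (?r (fst z)))" "mono_on {0<..<1} (H' k (?r (snd z)))"
            using H(1) H'(1) k r_space by (auto simp: monotone_transport_def)
          note [measurable] = measurable_mono_unit_itv[OF mono(1)] measurable_mono_unit_itv[OF mono(2)]
          have "(\<integral>\<^sup>+v. ?c v \<partial>\<sigma> k (?rr z))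
              = (\<integral>\<^sup>+t. ennreal (\<bar>H k (?r (fst z)) t - H' k (?r (snd z)) t\<bar> powr p) \<partial>unit_itv)"
            unfolding \<sigma>_def comonotone_kernel_def fst_conv snd_conv by (subst nn_integral_distr) auto
          also have "\<dots> \<le> ennreal (3 powr p) * (ennreal (L powr p * lp_pow p k (\<lambda>i. fst z i - fst w i))
              + R + ennreal (L powr p * lp_pow p k (\<lambda>i. snd w i - snd z i)))"
            using comonotone_cost_lipschitz[OF p L lip \<kappa>_in(1)[OF r_space] \<kappa>_in(2)[OF r_space]
                r_space r_space r_space r_space mono(1) _ mono(2) _ w] z
            by (simp only: lp_pow_restrict case_prod_unfold R_def)
          also have "\<dots> \<le> ennreal (3 powr p) * (ennreal (L powr p * e) + R
              + ennreal (L powr p * (3 powr p * (?S w + e + ?S z))))"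
            using near far by (intro mult_left_mono add_mono ennreal_leI) auto
          also have "\<dots> \<le> ennreal ?C * (R + ennreal (?S w) + ennreal e) + ennreal ?C * ennreal (?S z)"
          proof (cases R)
            case (real s)
            have nine: "(3::real) powr p * 3 powr p = 9 powr p" by (simp flip: powr_mult)
            have "3 powr p * (L powr p * e + s + L powr p * (3 powr p * (?S w + e + ?S z)))
                = 3 powr p * s + 9 powr p * L powr p * (?S w + ?S z)
                  + (3 powr p + 9 powr p) * L powr p * e"
              by (simp add: nine[symmetric] algebra_simps)
            also have "\<dots> \<le> ?C * s + ?C * (?S w + ?S z) + ?C * e"
            proof (intro add_mono mult_right_mono)
              have "(3::real) powr p \<le> 9 powr p" using p by (intro powr_mono2) auto
              then have "(3 powr p + 9 powr p) * L powr p \<le> (2 * 9 powr p) * L powr p"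
                by (intro mult_right_mono) auto
              also have "\<dots> \<le> ?C" by (simp add: growth_const_def)
              finally show "(3 powr p + 9 powr p) * L powr p \<le> ?C" .
            qed (use real e in \<open>auto simp: growth_const_def\<close>)
            also have "\<dots> = ?C * (s + ?S w + e) + ?C * ?S z" by (simp add: algebra_simps)
            finally show ?thesis using real e growth_const_pos[of p L]
              by (simp add: ennreal_leI flip: ennreal_plus ennreal_mult')
          next
            case top
            then show ?thesis using growth_const_pos[of p L] by (simp add: ennreal_mult_top)
          qed
          finally show "(\<integral>\<^sup>+v. ?c v \<partial>\<sigma> k (?rr z)) \<le> g w + ennreal ?C * ennreal (?S z)"
            by (simp add: g_def R_def)
        qed
      qed
    qed measurable
    also have "(\<integral>\<^sup>+w. g w \<partial>\<pi>) = ennreal ?C * ((\<integral>\<^sup>+w. (\<integral>\<^sup>+v. ?c v \<partial>\<rho> k (?rr w)) \<partial>\<pi>)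
        + (\<integral>\<^sup>+w. ennreal (?S w) \<partial>\<pi>) + ennreal e)"
      unfolding g_def by (simp add: nn_integral_cmult nn_integral_add \<pi>.emeasure_space_1)
    also have "(\<integral>\<^sup>+z. ennreal ?C * ennreal (?S z) \<partial>\<gamma>) = ennreal ?C * (\<integral>\<^sup>+z. ennreal (?S z) \<partial>\<gamma>)"
      by (rule nn_integral_cmult) measurable
    finally have "(\<integral>\<^sup>+z. (\<integral>\<^sup>+v. ?c v \<partial>\<sigma> k (?rr z)) \<partial>\<gamma>)
        \<le> ennreal ?C * ((\<integral>\<^sup>+w. (\<integral>\<^sup>+v. ?c v \<partial>\<rho> k (?rr w)) \<partial>\<pi>)
          + (\<integral>\<^sup>+w. ennreal (?S w) \<partial>\<pi>) + ennreal e) + ennreal ?C * (\<integral>\<^sup>+z. ennreal (?S z) \<partial>\<gamma>)" .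
    moreover have "ennreal (?C * (real k * \<epsilon> powr p)) = ennreal ?C * ennreal e"
      unfolding e_def using growth_const_pos[of p L] by (intro ennreal_mult') simp
    ultimately show ?thesis
      unfolding \<gamma>_step S_Suc by (simp only: distrib_left add_ac)
  qed
  show ?thesis
  proof (rule ennreal_le_epsilon)
    fix \<delta> :: real assume "\<delta> > 0"
    \<comment> \<open>Chosen so that the mesh error \<open>?C * (real k * \<epsilon> powr p)\<close>
      is at most \<open>\<delta>\<close>; the \<open>+ 1\<close> keeps the denominator positive for
      \<open>k = 0\<close>.\<close>
    define \<epsilon> where "\<epsilon> = (\<delta> / (?C * real k + 1)) powr (1 / p)"
    have pos: "?C * real k + 1 > 0" using growth_const_pos[of p L] by (intro add_nonneg_pos) auto
    then have "\<epsilon> > 0" using \<open>\<delta> > 0\<close> by (simp add: \<epsilon>_def)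
    have "\<epsilon> powr p = \<delta> / (?C * real k + 1)" using p \<open>\<delta> > 0\<close> pos by (simp add: \<epsilon>_def powr_powr)
    then have "?C * (real k * \<epsilon> powr p) = (?C * real k) * (\<delta> / (?C * real k + 1))" by simp
    also have "\<dots> \<le> (?C * real k + 1) * (\<delta> / (?C * real k + 1))"
      using pos \<open>\<delta> > 0\<close> by (intro mult_right_mono) auto
    also have "\<dots> = \<delta>" using pos by simp
    finally have "?C * (real k * \<epsilon> powr p) \<le> \<delta>" .
    then show "(\<integral>\<^sup>+z. ennreal (\<bar>fst z k - snd z k\<bar> powr p) \<partial>\<gamma>)
      \<le> ennreal ?C * ((\<integral>\<^sup>+w. ennreal (lp_pow p (Suc k) (\<lambda>i. fst w i - snd w i)) \<partial>\<pi>)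
        + (\<integral>\<^sup>+z. ennreal (?S z) \<partial>\<gamma>)) + ennreal \<delta>"
      using approx[OF \<open>\<epsilon> > 0\<close>] by (elim order.trans) (intro add_left_mono ennreal_leI)
  qed
qed

text \<open>A discrete Gronwall argument. If \<open>a\<close> is the factor reached after
  \<open>k\<close> steps and \<open>C\<close> the growth constant, the next step produces
  \<open>a + C * (1 + a)\<close>, which is at most \<open>(1 + 2 * C) * a\<close> because
  \<open>a \<ge> 1\<close>.\<close>

lemma bicausal_cost_le:
  assumes p: "p \<ge> 1" and L: "L > 0" and "k \<le> N"
    and \<mu>: "disintegration N \<mu> \<kappa>" and \<nu>: "disintegration N \<nu> \<eta>"
    and lip: "\<And>k. k < N \<Longrightarrow> lipschitz_kernel p L k (\<kappa> k)" "\<And>k. k < N \<Longrightarrow> lipschitz_kernel p L k (\<eta> k)"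
    and H: "monotone_transport N H" "distr (unit_cube N) (RN N) (composed H N) = \<mu>"
    and H': "monotone_transport N H'" "distr (unit_cube N) (RN N) (composed H' N) = \<nu>"
    and \<gamma>: "\<gamma> = distr (unit_cube N) (RN N \<Otimes>\<^sub>M RN N) (\<lambda>u. (composed H N u, composed H' N u))"
    and \<pi>: "\<pi> \<in> bicausal_couplings N \<mu> \<nu>"
  shows "(\<integral>\<^sup>+z. ennreal (lp_pow p k (\<lambda>i. fst z i - snd z i)) \<partial>\<gamma>)
    \<le> ennreal ((1 + 2 * growth_const p L) ^ k) * (\<integral>\<^sup>+z. ennreal (lp_pow p k (\<lambda>i. fst z i - snd z i)) \<partial>\<pi>)"
  using \<open>k \<le> N\<close>
proof (induction k)
  case 0
  then show ?case by (simp add: lp_pow_def)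
next
  case (Suc k)
  then have k: "k < N" by simp
  let ?C = "growth_const p L"
  have C: "?C > 0" by (rule growth_const_pos)
  define A where "A = (\<integral>\<^sup>+z. ennreal (lp_pow p k (\<lambda>i. fst z i - snd z i)) \<partial>\<gamma>)"
  define B where "B = (\<integral>\<^sup>+z. ennreal (lp_pow p (Suc k) (\<lambda>i. fst z i - snd z i)) \<partial>\<pi>)"
  have [measurable_cong]: "sets \<gamma> = sets (RN N \<Otimes>\<^sub>M RN N)" by (simp add: \<gamma>)
  have [measurable]: "(\<lambda>x. x i) \<in> borel_measurable (RN N)" if "i < N" for i
    using that by (intro measurable_component_singleton) auto
  have [measurable]: "(\<lambda>z. lp_pow p k (\<lambda>i. fst z i - snd z i)) \<in> borel_measurable (RN N \<Otimes>\<^sub>M RN N)"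
    unfolding lp_pow_def using k by (intro borel_measurable_sum) measurable
  \<comment> \<open>The partial cost of \<open>\<pi>\<close> can only grow with another coordinate,
    so the induction hypothesis can be expressed through \<open>B\<close>.\<close>
  have "(\<integral>\<^sup>+z. ennreal (lp_pow p k (\<lambda>i. fst z i - snd z i)) \<partial>\<pi>) \<le> B"
    unfolding B_def by (intro nn_integral_mono ennreal_leI) (simp add: lp_pow_Suc)
  then have "A \<le> ennreal ((1 + 2 * ?C) ^ k) * B"
    unfolding A_def using Suc.IH k by (meson less_imp_le mult_left_mono order.trans zero_le)
  have "(\<integral>\<^sup>+z. ennreal (lp_pow p (Suc k) (\<lambda>i. fst z i - snd z i)) \<partial>\<gamma>)
      = A + (\<integral>\<^sup>+z. ennreal (\<bar>fst z k - snd z k\<bar> powr p) \<partial>\<gamma>)"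
    unfolding A_def using k by (simp add: lp_pow_Suc nn_integral_add)
  also have "\<dots> \<le> A + ennreal ?C * (B + A)"
    using bicausal_cost_step[OF p L k \<mu> \<nu> lip(1)[OF k] lip(2)[OF k] H H' \<gamma> \<pi>]
    unfolding A_def B_def by (intro add_left_mono)
  also have "\<dots> \<le> ennreal ((1 + 2 * ?C) ^ k) * B + ennreal ?C * (B + ennreal ((1 + 2 * ?C) ^ k) * B)"
    using \<open>A \<le> _\<close> by (intro add_mono mult_left_mono) auto
  also have "\<dots> = ennreal ((1 + 2 * ?C) ^ k + ?C * (1 + (1 + 2 * ?C) ^ k)) * B"
    using C by (simp add: ennreal_plus ennreal_mult algebra_simps)
  also have "\<dots> \<le> ennreal ((1 + 2 * ?C) ^ Suc k) * B"
  proof (intro mult_right_mono ennreal_leI)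
    have "1 \<le> (1 + 2 * ?C) ^ k" using C by (intro one_le_power) auto
    then have "?C * 1 \<le> ?C * (1 + 2 * ?C) ^ k" using C by (intro mult_left_mono) auto
    then show "(1 + 2 * ?C) ^ k + ?C * (1 + (1 + 2 * ?C) ^ k) \<le> (1 + 2 * ?C) ^ Suc k"
      by (simp add: algebra_simps)
  qed simp
  finally show ?case by (simp only: B_def)
qed

theorem theorem3p1:
  fixes N :: nat and p L :: real
  assumes "p \<ge> 1" and "L > 0"
  shows "\<exists>C::real. C > 0 \<and> (\<forall>\<mu>\<in>P_pL p L N. \<forall>\<nu>\<in>P_pL p L N.
           AW p N \<mu> \<nu> \<le> KR p N \<mu> \<nu> \<and> KR p N \<mu> \<nu> \<le> ennreal C * AW p N \<mu> \<nu>)"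
proof -
  define K where "K = (1 + 2 * growth_const p L) ^ N"
  have K: "K > 0" unfolding K_def using growth_const_pos[of p L] by (intro zero_less_power) simp
  \<comment> \<open>\<open>K\<close> compares the integrals of the p-th powers; the distances are
    compared by its p-th root.\<close>
  define C where "C = K powr (1 / p)"
  have C: "C > 0" using K by (simp add: C_def)
  have "AW p N \<mu> \<nu> \<le> KR p N \<mu> \<nu> \<and> KR p N \<mu> \<nu> \<le> ennreal C * AW p N \<mu> \<nu>"
    if \<mu>_in: "\<mu> \<in> P_pL p L N" and \<nu>_in: "\<nu> \<in> P_pL p L N" for \<mu> \<nu>
  proof -
    obtain \<kappa> where \<mu>: "disintegration N \<mu> \<kappa>" and \<kappa>: "\<And>k. k < N \<Longrightarrow> lipschitz_kernel p L k (\<kappa> k)"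
      using \<mu>_in unfolding P_pL_def lipschitz_kernel_def by blast
    obtain \<eta> where \<nu>: "disintegration N \<nu> \<eta>" and \<eta>: "\<And>k. k < N \<Longrightarrow> lipschitz_kernel p L k (\<eta> k)"
      using \<nu>_in unfolding P_pL_def lipschitz_kernel_def by blast
    obtain H where H: "monotone_transport N H" "distr (unit_cube N) (RN N) (composed H N) = \<mu>"
      and QH: "\<And>u. u \<in> space (unit_cube N) \<Longrightarrow> the_quantile_process N \<mu> u = composed H N u"
      using the_quantile_process_composed[OF \<mu>] by blast
    obtain H' where H': "monotone_transport N H'" "distr (unit_cube N) (RN N) (composed H' N) = \<nu>"
      and QH': "\<And>u. u \<in> space (unit_cube N) \<Longrightarrow> the_quantile_process N \<nu> u = composed H' N u"
      using the_quantile_process_composed[OF \<nu>] by blast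
    define \<gamma> where "\<gamma> = distr (unit_cube N) (RN N \<Otimes>\<^sub>M RN N) (\<lambda>u. (composed H N u, composed H' N u))"
    have KR: "KR p N \<mu> \<nu> = ennroot p (\<integral>\<^sup>+(x, y). ennreal (lp_pow p N (\<lambda>i. x i - y i)) \<partial>\<gamma>)"
      unfolding \<gamma>_def by (intro KR_eq_cost H(1) H'(1) QH QH')
    have "AW p N \<mu> \<nu> \<le> KR p N \<mu> \<nu>"
      unfolding KR AW_def using bicausal_composed[OF H H', folded \<gamma>_def] by (rule INF_lower)
    \<comment> \<open>Dividing by \<open>C\<close> makes the claim a lower bound for each single
      coupling, which passes to the infimum.\<close>
    moreover have "KR p N \<mu> \<nu> / ennreal C \<le> AW p N \<mu> \<nu>"
      unfolding AW_def
    proof (rule INF_greatest)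
      fix \<pi> assume \<pi>: "\<pi> \<in> bicausal_couplings N \<mu> \<nu>"
      have "KR p N \<mu> \<nu> \<le> ennroot p (ennreal K * (\<integral>\<^sup>+(x, y). ennreal (lp_pow p N (\<lambda>i. x i - y i)) \<partial>\<pi>))"
        unfolding KR K_def case_prod_unfold
        using bicausal_cost_le[OF assms order.refl \<mu> \<nu> \<kappa> \<eta> H H' \<gamma>_def \<pi>] assms
        by (intro ennroot_mono) auto
      also have "\<dots> \<le> ennreal C * ennroot p (\<integral>\<^sup>+(x, y). ennreal (lp_pow p N (\<lambda>i. x i - y i)) \<partial>\<pi>)"
        unfolding C_def using K assms by (intro ennroot_mult) auto
      finally show "KR p N \<mu> \<nu> / ennreal C \<le> ennroot p (\<integral>\<^sup>+(x, y). ennreal (lp_pow p N (\<lambda>i. x i - y i)) \<partial>\<pi>)"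
        using C by (subst divide_le_posI_ennreal) (auto simp: mult.commute)
    qed
    from mult_left_mono[OF this zero_le] have "ennreal C * (KR p N \<mu> \<nu> / ennreal C) \<le> ennreal C * AW p N \<mu> \<nu>"
      .
    moreover have "ennreal C * (KR p N \<mu> \<nu> / ennreal C) = KR p N \<mu> \<nu>"
      unfolding ennreal_times_divide mult.commute[of "ennreal C"]
      using C by (intro ennreal_mult_divide_eq) auto
    ultimately show ?thesis by simp
  qed
  with C show ?thesis by blast
qed

end
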